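(* Let $0<t<1$, $\mu_1,\mu_2\in\mathbb{R}$, $\sigma_1,\sigma_2>0$ with $(\mu_1,\sigma_1)\ne(\mu_2,\sigma_2)$, and let $X_1,X_2,\dots$ be i.i.d. real random variables with probability density $$\frac{1-t}{\pi}\frac{\sigma_1}{(x-\mu_1)^2+\sigma_1^2}+\frac{t}{\pi}\frac{\sigma_2}{(x-\mu_2)^2+\sigma_2^2}.$$ Let $0<\alpha<1/6$, $a_1=(\mu_1+\sigma_1 i)^\alpha$, $a_2=(\mu_2+\sigma_2 i)^\alpha$, $B_j=E[X_1^{j\alpha}]$ for $1\le j\le 3$, and $B=(B_1,B_2,B_3)$. Then $a_1\ne a_2$, $t=\frac{a_1-B_1}{a_1-a_2}$ and $\mu_j+\sigma_j i=a_j^{1/\alpha}$ for $j=1,2$. Define $$F_1(x_1,x_2,x_3)=\frac{x_3-x_1x_2}{2(x_2-x_1^2)},\qquad F_2(x_1,x_2,x_3)=F_1(x_1,x_2,x_3)^2-\frac{x_1x_3-x_2^2}{x_2-x_1^2},$$ $$F_3=F_1+\sqrt{F_2},\quad F_4=F_1-\sqrt{F_2},\quad F_5=\frac{4F_1^2}{F_1^2-F_2}-2,\quad F_6=F_5^2-4.$$ Label the two components so that $a_1=F_3(B)$ and $a_2=F_4(B)$. Let $\overline{X}_n=\frac1n\sum_{j=1}^n (X_j^\alpha,X_j^{2\alpha},X_j^{3\alpha})$, $\hat a_{1,n}=F_3(\overline{X}_n)$ and $\hat a_{2,n}=F_4(\overline{X}_n)$. Then: (i) Almost surely, the sets $\{\hat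 a_{1,n},\hat a_{2,n}\}$ converge to the set $\{a_1,a_2\}$ in the Hausdorff distance as $n\to\infty$. (ii) If $\mathrm{Re}(a_1-a_2)\ne0$, then $\sqrt n(\hat a_{1,n}-a_1)$ converges weakly, as $n\to\infty$, to a $2$-dimensional normal distribution $N(0,\Sigma^{(1)})$ with $\Sigma^{(1)}$ a non-negative definite matrix of degree $2$, and $\hat a_{2,n}$ is likewise a $\sqrt n$-consistent estimator of $a_2$. (iii) It holds that $F_5(B)=\frac{a_1}{a_2}+\frac{a_2}{a_1}$ and $F_6(B)=\left(\frac{a_1}{a_2}-\frac{a_2}{a_1}\right)^2$. If $\mathrm{Re}(a_1-a_2)=0$, then $|a_1|\ne|a_2|$, hence $F_6(B)\notin(-\infty,0]$, and, in the same manner as in (ii) (using $F_5(\overline X_n)$ and $\sqrt{F_6(\overline X_n)}$), one has a $\sqrt n$-consistent estimator of $a_2/a_1$, and hence also a $\sqrt n$-consistent estimator of $a_1=(a_1+a_2)/(1+a_2/a_1)$. The condition $|a_1|\ne|a_2|$ is equivalent to $\mu_1^2+\sigma_1^2\ne\mu_2^2+\sigma_2^2$, which does not depend on $\alpha$. (iv) Through $t=\frac{a_1-B_1}{a_1-a_2}$ and $\mu_j+\sigma_j i=a_j^{1/\alpha}$, these two constructions give strongly consistent and $\sqrt n$-consistent estimators, in closed form, of each of the five parameters $t,\mu_1,\sigma_1,\mu_2,\sigma_2$.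
   Context: $\mathbb{C}$ is identified with $\mathbb{R}^2$. Complex powers use the principal branch: $z^q=\exp(q\log z)$ with $\log z=\log r+i\theta$ for $z=r e^{i\theta}$, $r>0$, $\theta\in(-\pi,\pi]$, and $0^q=0$ for $0<q<1$; $\sqrt{\cdot}$ is the principal square root. The model is symmetric under simultaneously exchanging $t$ with $1-t$ and $(\mu_1,\sigma_1)$ with $(\mu_2,\sigma_2)$, so the two components may be labelled in either order. An estimator $\hat\theta_n$ of $\theta$ is $\sqrt n$-consistent if $\sqrt n(\hat\theta_n-\theta)$ is bounded in probability. *)

theory Defs
  imports "HOL-Probability.Probability"
begin

section \<open>The model\<close>

definition cauchy_mixture_density ::
    "real \<Rightarrow> real \<Rightarrow> real \<Rightarrow> real \<Rightarrow> real \<Rightarrow> real \<Rightarrow> real" where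
  "cauchy_mixture_density t \<mu>1 \<sigma>1 \<mu>2 \<sigma>2 x =
     (1 - t) / pi * (\<sigma>1 / ((x - \<mu>1)\<^sup>2 + \<sigma>1\<^sup>2)) +
     t / pi * (\<sigma>2 / ((x - \<mu>2)\<^sup>2 + \<sigma>2\<^sup>2))"

text \<open>
  On the complex numbers, \<open>powr\<close> is the principal power, with the argument in
  \<open>(-pi, pi]\<close> (so that negative reals have argument \<open>pi\<close>) and \<open>0 powr q = 0\<close>;
  \<open>csqrt\<close> is the principal square root.
\<close>

definition cpow :: "real \<Rightarrow> real \<Rightarrow> complex" where
  "cpow x q = complex_of_real x powr complex_of_real q"

definition moments :: "'a measure \<Rightarrow> real \<Rightarrow> ('a \<Rightarrow> real) \<Rightarrow> complex \<times> complex \<times> complex" where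
  "moments M \<alpha> Y =
     (LINT \<omega>|M. cpow (Y \<omega>) \<alpha>, LINT \<omega>|M. cpow (Y \<omega>) (2 * \<alpha>), LINT \<omega>|M. cpow (Y \<omega>) (3 * \<alpha>))"

text \<open>
  The observations are indexed from \<open>0\<close>: the sample of size \<open>n\<close> is \<open>X 0, ..., X (n - 1)\<close>.
\<close>

definition sample_moments ::
    "real \<Rightarrow> (nat \<Rightarrow> 'a \<Rightarrow> real) \<Rightarrow> nat \<Rightarrow> 'a \<Rightarrow> complex \<times> complex \<times> complex" where
  "sample_moments \<alpha> X n \<omega> =
     ((\<Sum>j<n. cpow (X j \<omega>) \<alpha>) / of_nat n,
      (\<Sum>j<n. cpow (X j \<omega>) (2 * \<alpha>)) / of_nat n,
      (\<Sum>j<n. cpow (X j \<omega>) (3 * \<alpha>)) / of_nat n)"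


section \<open>The functions in the closed-form estimators\<close>

definition F1 :: "complex \<times> complex \<times> complex \<Rightarrow> complex" where
  "F1 = (\<lambda>(x1, x2, x3). (x3 - x1 * x2) / (2 * (x2 - x1\<^sup>2)))"

definition F2 :: "complex \<times> complex \<times> complex \<Rightarrow> complex" where
  "F2 = (\<lambda>(x1, x2, x3). (F1 (x1, x2, x3))\<^sup>2 - (x1 * x3 - x2\<^sup>2) / (x2 - x1\<^sup>2))"

definition F3 :: "complex \<times> complex \<times> complex \<Rightarrow> complex" where
  "F3 x = F1 x + csqrt (F2 x)"

definition F4 :: "complex \<times> complex \<times> complex \<Rightarrow> complex" where
  "F4 x = F1 x - csqrt (F2 x)"

definition F5 :: "complex \<times> complex \<times> complex \<Rightarrow> complex" where
  "F5 x = 4 * (F1 x)\<^sup>2 / ((F1 x)\<^sup>2 - F2 x) - 2"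

definition F6 :: "complex \<times> complex \<times> complex \<Rightarrow> complex" where
  "F6 x = (F5 x)\<^sup>2 - 4"

text \<open>
  At the population moments, \<open>F5\<close> and \<open>csqrt F6\<close> are \<open>a1/a2 + a2/a1\<close> and
  \<open>\<plusminus>(a1/a2 - a2/a1)\<close>. If \<open>Re (a1 - a2) = 0\<close>, the labelling \<open>a1 = F3 B\<close>, \<open>a2 = F4 B\<close>
  makes \<open>Im a1 > Im a2 > 0\<close>, hence \<open>|a1| > |a2|\<close>, so the sign is \<open>+\<close> and
  \<open>(F5 - csqrt F6) / 2\<close> is \<open>a2/a1\<close>. Moreover \<open>2 * F1\<close> is \<open>a1 + a2\<close>.
\<close>

definition ratio_est :: "complex \<times> complex \<times> complex \<Rightarrow> complex" where
  "ratio_est x = (F5 x - csqrt (F6 x)) / 2"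

definition a1_est :: "complex \<times> complex \<times> complex \<Rightarrow> complex" where
  "a1_est x = 2 * F1 x / (1 + ratio_est x)"

definition a2_est :: "complex \<times> complex \<times> complex \<Rightarrow> complex" where
  "a2_est x = ratio_est x * a1_est x"


section \<open>Modes of convergence\<close>

text \<open>Meaningful for nonempty bounded sets.\<close>

definition hausdorff_dist :: "'a::metric_space set \<Rightarrow> 'a set \<Rightarrow> real" where
  "hausdorff_dist S T = max (SUP x\<in>S. infdist x T) (SUP y\<in>T. infdist y S)"

definition strongly_consistent ::
    "'a measure \<Rightarrow> (nat \<Rightarrow> 'a \<Rightarrow> 'b::real_normed_vector) \<Rightarrow> 'b \<Rightarrow> bool" where
  "strongly_consistent M est \<theta> \<longleftrightarrow>
     (\<forall>n. est n \<in> borel_measurable M) \<and> (AE \<omega> in M. (\<lambda>n. est n \<omega>) \<longlonglongrightarrow> \<theta>)"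

definition sqrt_n_consistent ::
    "'a measure \<Rightarrow> (nat \<Rightarrow> 'a \<Rightarrow> 'b::real_normed_vector) \<Rightarrow> 'b \<Rightarrow> bool" where
  "sqrt_n_consistent M est \<theta> \<longleftrightarrow>
     (\<forall>n. est n \<in> borel_measurable M) \<and>
     (\<forall>\<epsilon>>0. \<exists>K. \<forall>n. measure M {\<omega> \<in> space M. norm (sqrt (real n) *\<^sub>R (est n \<omega> - \<theta>)) > K} \<le> \<epsilon>)"

definition weakly_converges ::
    "(nat \<Rightarrow> 'b::topological_space measure) \<Rightarrow> 'b measure \<Rightarrow> bool" where
  "weakly_converges \<nu> N \<longleftrightarrow>
     (\<forall>f :: 'b \<Rightarrow> real. continuous_on UNIV f \<and> bounded (range f) \<longrightarrow>
        (\<lambda>n. LINT x|\<nu> n. f x) \<longlonglongrightarrow> (LINT x|N. f x))"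

definition nonneg_definite :: "real ^ 'n ^ 'n \<Rightarrow> bool" where
  "nonneg_definite S \<longleftrightarrow> transpose S = S \<and> (\<forall>u. 0 \<le> u \<bullet> (S *v u))"

text \<open>
  The normal distribution with mean \<open>m\<close> and covariance matrix \<open>S\<close> is given by its
  characteristic function, since \<open>S\<close> may be singular (and there is then no density).
\<close>

definition normal_distribution :: "real ^ 'n \<Rightarrow> real ^ 'n ^ 'n \<Rightarrow> (real ^ 'n) measure \<Rightarrow> bool" where
  "normal_distribution m S N \<longleftrightarrow>
     prob_space N \<and> sets N = sets borel \<and>
     (\<forall>u. (LINT x|N. exp (\<i> * complex_of_real (u \<bullet> x))) =
          exp (\<i> * complex_of_real (u \<bullet> m) - complex_of_real (u \<bullet> (S *v u)) / 2))"

definition to_R2 :: "complex \<Rightarrow> real ^ 2" where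
  "to_R2 z = vector [Re z, Im z]"


section \<open>Plug-in estimators of the five parameters\<close>

text \<open>
  Given estimators \<open>b1\<close>, \<open>b2\<close> of \<open>a1\<close>, \<open>a2\<close> and the first sample moment \<open>m\<close>, the plug-in
  estimator of \<open>t = (a1 - B1) / (a1 - a2)\<close> is complex-valued; both it and its real part
  are considered.
\<close>

definition plug_in_t :: "(nat \<Rightarrow> 'a \<Rightarrow> complex) \<Rightarrow> (nat \<Rightarrow> 'a \<Rightarrow> complex) \<Rightarrow> (nat \<Rightarrow> 'a \<Rightarrow> complex) \<Rightarrow>
    nat \<Rightarrow> 'a \<Rightarrow> complex" where
  "plug_in_t m b1 b2 n \<omega> = (b1 n \<omega> - m n \<omega>) / (b1 n \<omega> - b2 n \<omega>)"

definition plug_in_loc_scale :: "real \<Rightarrow> (nat \<Rightarrow> 'a \<Rightarrow> complex) \<Rightarrow> nat \<Rightarrow> 'a \<Rightarrow> complex" where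
  "plug_in_loc_scale \<alpha> b n \<omega> = b n \<omega> powr complex_of_real (1 / \<alpha>)"

definition consistent_plug_in ::
    "'a measure \<Rightarrow> real \<Rightarrow> (nat \<Rightarrow> 'a \<Rightarrow> complex) \<Rightarrow> (nat \<Rightarrow> 'a \<Rightarrow> complex) \<Rightarrow> (nat \<Rightarrow> 'a \<Rightarrow> complex) \<Rightarrow>
     real \<Rightarrow> real \<Rightarrow> real \<Rightarrow> real \<Rightarrow> real \<Rightarrow> bool" where
  "consistent_plug_in M \<alpha> m b1 b2 t \<mu>1 \<sigma>1 \<mu>2 \<sigma>2 \<longleftrightarrow>
     strongly_consistent M (plug_in_t m b1 b2) (complex_of_real t) \<and>
     sqrt_n_consistent M (plug_in_t m b1 b2) (complex_of_real t) \<and>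
     (\<forall>(est, \<theta>) \<in> {(\<lambda>n \<omega>. Re (plug_in_t m b1 b2 n \<omega>), t),
                    (\<lambda>n \<omega>. Re (plug_in_loc_scale \<alpha> b1 n \<omega>), \<mu>1),
                    (\<lambda>n \<omega>. Im (plug_in_loc_scale \<alpha> b1 n \<omega>), \<sigma>1),
                    (\<lambda>n \<omega>. Re (plug_in_loc_scale \<alpha> b2 n \<omega>), \<mu>2),
                    (\<lambda>n \<omega>. Im (plug_in_loc_scale \<alpha> b2 n \<omega>), \<sigma>2)}.
        strongly_consistent M est \<theta> \<and> sqrt_n_consistent M est \<theta>)"

end

theory Submission
  imports Defs "HOL-Complex_Analysis.Complex_Analysis" "HOL-Real_Asymp.Real_Asymp"
    "HOL-Library.Discrete_Functions"
begin

text \<open>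
  The power function \<open>z \<mapsto> z\<^sup>q\<close> is holomorphic in the upper half plane, continuous up to the
  real line, and of order \<open>q < 1\<close> at infinity; the Cauchy density with location \<open>\<mu>\<close> and scale
  \<open>\<sigma>\<close> is the Poisson kernel of the point \<open>z = \<mu> + \<sigma> i\<close>. Hence the \<open>q\<close>-th power moment of that
  distribution is the value \<open>z\<^sup>q\<close> at that point (\<open>integral_poisson_cpow\<close>). With
  \<open>a\<^sub>j = (\<mu>\<^sub>j + \<sigma>\<^sub>j i)\<^sup>\<alpha>\<close> the population moments are therefore
  \<open>B\<^sub>j = (1 - t) a\<^sub>1\<^sup>j + t a\<^sub>2\<^sup>j\<close>: these are the first three moments of a two-point mixture on
  \<open>{a\<^sub>1, a\<^sub>2}\<close>, and \<open>a\<^sub>1, a\<^sub>2\<close> are the roots of a quadratic equation whose coefficients are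
  rational in \<open>B\<close>. The function \<open>F1\<close> is half the sum of the roots and \<open>F2\<close> is the square of
  half their difference, which is what \<open>F1_mixture\<close> and \<open>F2_mixture\<close> verify.

  The estimators are thus functions \<open>g\<close> of the mean of the i.i.d. vectors
  \<open>(X\<^sup>\<alpha>, X\<^sup>2\<^sup>\<alpha>, X\<^sup>3\<^sup>\<alpha>)\<close>. These have finite second moments, because \<open>6 \<alpha> < 1\<close> and the density
  decays quadratically. For such vectors the strong law (\<open>strong_law\<close>) gives strong consistency
  when \<open>g\<close> is continuous at \<open>B\<close>; the mean square error of order \<open>1/n\<close>
  (\<open>mean_square_error\<close>) gives \<open>\<surd>n\<close>-consistency when \<open>g\<close> is differentiable at \<open>B\<close>
  (\<open>sqrt_n_consistent_differentiable\<close>); and the central limit theorem for the linearization of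
  \<open>g\<close> gives asymptotic normality (\<open>delta_method\<close>). The latter rests on a multivariate
  continuity theorem, \<open>weakly_converges_char_tight\<close>: tightness together with pointwise
  convergence of characteristic functions implies weak convergence.

  It remains to see where the square roots are differentiable. If \<open>Re (a\<^sub>1 - a\<^sub>2) \<noteq> 0\<close>, then
  \<open>F2 B = ((a\<^sub>1 - a\<^sub>2)/2)\<^sup>2\<close> is off the branch cut, so \<open>F3\<close> and \<open>F4\<close> are differentiable at
  \<open>B\<close>. If \<open>Re (a\<^sub>1 - a\<^sub>2) = 0\<close>, then \<open>F2 B\<close> is on the cut, but the labelling forces
  \<open>Im a\<^sub>1 > Im a\<^sub>2\<close>; both points lie in the open first quadrant, so \<open>|a\<^sub>1| > |a\<^sub>2|\<close>, and then
  \<open>a\<^sub>1/a\<^sub>2 - a\<^sub>2/a\<^sub>1\<close> has positive real part (\<open>Re_ratio_difference_pos\<close>). This is the root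
  taken by \<open>csqrt (F6 B)\<close>, so \<open>ratio_est\<close> is differentiable at \<open>B\<close> with value \<open>a\<^sub>2/a\<^sub>1\<close>.
  Convergence of the unordered pair \<open>{F3, F4}\<close> survives on the cut as well, since crossing it
  only exchanges the two roots (\<open>hausdorff_dist_plus_minus\<close>).
\<close>


section \<open>Power moments of the Cauchy distribution\<close>

text \<open>The Cauchy density times \<open>\<pi>\<close>.\<close>

definition poisson_kernel :: "real \<Rightarrow> real \<Rightarrow> real \<Rightarrow> real" where
  "poisson_kernel \<mu> \<sigma> x = \<sigma> / ((x - \<mu>)\<^sup>2 + \<sigma>\<^sup>2)"

lemma poisson_kernel_measurable [measurable]: "poisson_kernel \<mu> \<sigma> \<in> borel_measurable borel"
  unfolding poisson_kernel_def by measurable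

lemma poisson_kernel_nonneg: "\<sigma> > 0 \<Longrightarrow> 0 \<le> poisson_kernel \<mu> \<sigma> x"
  unfolding poisson_kernel_def by simp

text \<open>
  The explicit antiderivative \<open>(1 + x)\<^sup>p\<^sup>-\<^sup>1 / (p - 1)\<close> handles the right half line; reflection gives
  the left one.
\<close>

lemma integrable_one_plus_abs_powr:
  fixes p :: real
  assumes "p < 1"
  shows "integrable lborel (\<lambda>x. (1 + \<bar>x\<bar>) powr (p - 2))"
proof -
  define g where "g x = (1 + \<bar>x\<bar>) powr (p - 2) * indicator {0..} x" for x :: real
  have "(\<integral>\<^sup>+x. ennreal ((1 + \<bar>x\<bar>) powr (p - 2)) * indicator {0..} x \<partial>lborel)
        = ennreal (0 - (1 + 0) powr (p - 1) / (p - 1))"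
  proof (rule nn_integral_FTC_atLeast)
    fix x :: real assume x: "0 \<le> x"
    have "((\<lambda>x. (1 + x) powr (p - 1) / (p - 1)) has_real_derivative (1 + x) powr (p - 2)) (at x)"
      using x assms by (auto intro!: derivative_eq_intros)
    then show "((\<lambda>x. (1 + x) powr (p - 1) / (p - 1)) has_real_derivative (1 + \<bar>x\<bar>) powr (p - 2)) (at x)"
      using x by simp
  next
    have "((\<lambda>x::real. (1 + x) powr (p - 1)) \<longlongrightarrow> 0) at_top"
      using assms by (intro tendsto_neg_powr filterlim_tendsto_add_at_top[OF tendsto_const] filterlim_ident) auto
    from tendsto_divide[OF this tendsto_const[of "p - 1"]] 
    show "((\<lambda>x. (1 + x) powr (p - 1) / (p - 1)) \<longlongrightarrow> 0) at_top" using assms by simp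
  qed auto
  then have "(\<integral>\<^sup>+x. ennreal (g x) \<partial>lborel) < \<infinity>"
    unfolding g_def by (simp add: ennreal_mult ennreal_indicator)
  moreover have [measurable]: "g \<in> borel_measurable borel" unfolding g_def by measurable
  ultimately have g: "integrable lborel g"
    by (intro integrableI_nonneg) (auto simp: g_def)
  have g': "integrable lborel (\<lambda>x. g (- x))"
    using lborel_integrable_real_affine[OF g, of "-1" 0] by simp
  show ?thesis
    by (rule Bochner_Integration.integrable_bound[OF Bochner_Integration.integrable_add[OF g g']])
       (auto simp: g_def indicator_def)
qed

text \<open>
  The kernel is at most a multiple of \<open>(1 + |x|)\<^sup>-\<^sup>2\<close>, so it beats any growth of order below one.
\<close>

lemma integrable_poisson_kernel:
  fixes f :: "real \<Rightarrow> 'b::{banach, second_countable_topology}"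
  assumes "\<sigma> > 0" "p < 1" and [measurable]: "f \<in> borel_measurable borel"
    and bound: "\<And>x. norm (f x) \<le> C * (1 + \<bar>x\<bar>) powr p"
  shows "integrable lborel (\<lambda>x. poisson_kernel \<mu> \<sigma> x *\<^sub>R f x)"
proof -
  define A where "A = 1 + \<bar>\<mu>\<bar>"
  define K where "K = 2 + 2 * A\<^sup>2 / \<sigma>\<^sup>2"
  have C: "0 \<le> C"
  proof -
    have "0 \<le> norm (f 0)" by simp
    also have "\<dots> \<le> C" using bound[of 0] by simp
    finally show ?thesis .
  qed
  have K: "(1 + \<bar>x\<bar>)\<^sup>2 \<le> K * ((x - \<mu>)\<^sup>2 + \<sigma>\<^sup>2)" for x
  proof -
    have "(1 + \<bar>x\<bar>)\<^sup>2 \<le> (A + \<bar>x - \<mu>\<bar>)\<^sup>2"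
      unfolding A_def by (intro power_mono) auto
    also have "\<dots> \<le> 2 * A\<^sup>2 + 2 * (x - \<mu>)\<^sup>2"
    proof -
      have "0 \<le> (A - \<bar>x - \<mu>\<bar>)\<^sup>2" by simp
      then show ?thesis by (simp add: power2_sum power2_diff algebra_simps)
    qed
    also have "\<dots> \<le> K * ((x - \<mu>)\<^sup>2 + \<sigma>\<^sup>2)"
      using assms(1) unfolding K_def by (simp add: field_simps)
    finally show ?thesis .
  qed
  have pos: "(x - \<mu>)\<^sup>2 + \<sigma>\<^sup>2 > 0" for x
    using assms(1) by (simp add: add_nonneg_pos)
  have "norm (poisson_kernel \<mu> \<sigma> x *\<^sub>R f x) \<le> (\<sigma> * K * C) * (1 + \<bar>x\<bar>) powr (p - 2)" for x
  proof -
    have "poisson_kernel \<mu> \<sigma> x \<le> \<sigma> * K / (1 + \<bar>x\<bar>)\<^sup>2"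
      using K[of x] pos[of x] assms(1) unfolding poisson_kernel_def
      by (simp add: divide_simps)
    then have "\<bar>poisson_kernel \<mu> \<sigma> x\<bar> * norm (f x) \<le> (\<sigma> * K / (1 + \<bar>x\<bar>)\<^sup>2) * (C * (1 + \<bar>x\<bar>) powr p)"
      using bound[of x] poisson_kernel_nonneg[OF assms(1), of \<mu> x]
      by (intro mult_mono) auto
    then have "norm (poisson_kernel \<mu> \<sigma> x *\<^sub>R f x) \<le> (\<sigma> * K / (1 + \<bar>x\<bar>)\<^sup>2) * (C * (1 + \<bar>x\<bar>) powr p)"
      by simp
    also have "\<dots> = (\<sigma> * K * C) * (1 + \<bar>x\<bar>) powr (p - 2)"
      by (simp add: powr_diff)
    finally show ?thesis .
  qed
  then show ?thesis
    using C assms(1) by (intro Bochner_Integration.integrable_bound[OF integrable_mult_right[OF integrable_one_plus_abs_powr[OF assms(2)], of "\<sigma> * K * C"]])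
      (auto intro!: AE_I2 intro: order_trans[OF _ abs_ge_self])
qed

lemma integral_poisson_kernel:
  assumes "\<sigma> > 0"
  shows "(LINT x|lborel. poisson_kernel \<mu> \<sigma> x) = pi"
proof -
  define F where "F x = arctan ((x - \<mu>) / \<sigma>)" for x
  have pos: "(x - \<mu>)\<^sup>2 + \<sigma>\<^sup>2 \<noteq> 0" for x
    using assms by (simp add: add_nonneg_eq_0_iff)
  have D: "(F has_real_derivative poisson_kernel \<mu> \<sigma> x) (at x)" for x
    unfolding F_def poisson_kernel_def using assms pos[of x]
    by (auto intro!: derivative_eq_intros simp: divide_simps) (auto simp: field_simps power2_eq_square)
  have "(LBINT x=-\<infinity>..\<infinity>. poisson_kernel \<mu> \<sigma> x) = pi / 2 - (- (pi / 2))"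
  proof (rule interval_integral_FTC_nonneg(2)[where F = F])
    have "(F \<longlongrightarrow> pi/2) at_top" unfolding F_def
      by (rule filterlim_compose[OF tendsto_arctan_at_top]) (use assms in real_asymp)
    then show "((F \<circ> real_of_ereal) \<longlongrightarrow> pi/2) (at_left \<infinity>)"
      by (simp only: ereal_tendsto_simps)
    have "(F \<longlongrightarrow> -(pi/2)) at_bot" unfolding F_def
      by (rule filterlim_compose[OF tendsto_arctan_at_bot]) (use assms in real_asymp)
    then show "((F \<circ> real_of_ereal) \<longlongrightarrow> -(pi/2)) (at_right (-\<infinity>))"
      by (simp only: ereal_tendsto_simps)
    fix x show "isCont (poisson_kernel \<mu> \<sigma>) x"
      unfolding poisson_kernel_def using pos[of x] by (intro continuous_intros) auto
  qed (use assms D in \<open>auto simp: poisson_kernel_nonneg\<close>)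
  then show ?thesis
    by (simp add: interval_lebesgue_integral_def einterval_def set_lebesgue_integral_def)
qed

text \<open>
  The principal power jumps across the negative real axis, so it is not continuous in a
  neighbourhood of the real line. Turning the upper half plane by \<open>-\<pi>/2\<close> into the right half
  plane moves the branch cut away from it: this is the branch of the power function that is
  continuous on the closed upper half plane, and it agrees there with the principal power.
\<close>

definition uhp_powr :: "real \<Rightarrow> complex \<Rightarrow> complex" where
  "uhp_powr q w = exp (\<i> * of_real (pi * q / 2)) * (- \<i> * w) powr of_real q"

lemma uhp_powr_eq:
  assumes "Im w \<ge> 0"
  shows "uhp_powr q w = w powr of_real q"
proof (cases "w = 0")
  case False
  then have nz: "- \<i> * w \<noteq> 0" by simp
  have "Ln (\<i> * (- \<i> * w)) = Ln (- \<i> * w) + \<i> * of_real pi / 2"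
    using assms Ln_times_ii[OF nz] by auto
  then have "Ln w = Ln (- \<i> * w) + \<i> * of_real pi / 2" by simp
  then show ?thesis using False
    unfolding uhp_powr_def powr_def by (simp add: exp_add[symmetric] algebra_simps)
qed (simp add: uhp_powr_def)

lemma norm_uhp_powr: "norm (uhp_powr q w) = norm w powr q"
  unfolding uhp_powr_def by (simp add: norm_mult norm_powr_real_powr')

lemma continuous_on_uhp_powr:
  assumes "0 < q"
  shows "continuous_on {w. Im w \<ge> 0} (uhp_powr q)"
  unfolding uhp_powr_def using assms by (intro continuous_intros) auto

lemma field_differentiable_uhp_powr:
  assumes "Im w > 0"
  shows "uhp_powr q field_differentiable at w"
proof -
  have "- \<i> * w \<notin> \<real>\<^sub>\<le>\<^sub>0" using assms by (auto simp: complex_nonpos_Reals_iff)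
  then have "((\<lambda>w. exp (\<i> * of_real (pi * q / 2)) * (- \<i> * w) powr of_real q) has_field_derivative
     exp (\<i> * of_real (pi * q / 2)) * ((of_real q * (- \<i> * w) powr (of_real q - 1)) * (- \<i>))) (at w)"
    by (intro DERIV_cmult DERIV_chain2[OF has_field_derivative_powr]) (auto intro!: derivative_eq_intros)
  then show ?thesis unfolding uhp_powr_def[abs_def] field_differentiable_def by blast
qed

lemma cpow_eq_uhp_powr: "cpow x q = uhp_powr q (of_real x)"
  unfolding cpow_def by (simp add: uhp_powr_eq)

lemma norm_cpow: "norm (cpow x q) = \<bar>x\<bar> powr q"
  by (simp add: cpow_eq_uhp_powr norm_uhp_powr)

lemma cpow_measurable [measurable]: "(\<lambda>x. cpow x q) \<in> borel_measurable borel"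
  unfolding cpow_def by measurable

text \<open>
  Subtracting the value at \<open>z0\<close> makes the singularity of \<open>w \<mapsto> (w\<^sup>q - z0\<^sup>q) / ((w - z0) (w - cnj z0))\<close>
  in the upper half plane removable, so that Cauchy's theorem applies: the integral over the diameter is minus the one over the half circle, which is
  estimated trivially.
\<close>

lemma half_disc_integral_bound:
  fixes z0 :: complex and R q :: real
  assumes q: "0 < q" and z0: "Im z0 > 0" and R: "R > norm z0"
  obtains I where
    "((\<lambda>x. (cpow x q - z0 powr of_real q) / ((of_real x - z0) * (of_real x - cnj z0))) has_integral I) {-R..R}"
    "norm I \<le> (R powr q + norm z0 powr q) / (R - norm z0)\<^sup>2 * R * pi"
proof -
  define S where "S = {w. Im w \<ge> 0}"
  define g where "g w = (if w = z0 then deriv (uhp_powr q) z0 else (uhp_powr q w - uhp_powr q z0) / (w - z0))" for w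
  define k where "k w = g w / (w - cnj z0)" for w
  have R0: "R > 0" using R norm_ge_zero[of z0] by linarith
  have nz: "w - cnj z0 \<noteq> 0" if "w \<in> S" for w
    using that z0 unfolding S_def by (auto simp: complex_eq_iff)
  have conv: "convex S" unfolding S_def by (rule convex_halfspace_Im_ge)
  have int: "interior S = {w. Im w > 0}"
    unfolding S_def using interior_halfspace_ge[of \<i> 0] by (simp add: inner_complex_def)
  have contz0: "continuous (at z0) g"
  proof -
    have "(uhp_powr q has_field_derivative deriv (uhp_powr q) z0) (at z0)"
      using field_differentiable_uhp_powr[OF z0] by (simp add: field_differentiable_derivI)
    then have "((\<lambda>w. (uhp_powr q w - uhp_powr q z0) / (w - z0)) \<longlongrightarrow> deriv (uhp_powr q) z0) (at z0)"
      by (simp add: has_field_derivative_iff)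
    then have "(g \<longlongrightarrow> deriv (uhp_powr q) z0) (at z0)"
      by (rule Lim_transform_eventually) (auto simp: g_def eventually_at_filter)
    then show ?thesis by (simp add: continuous_within g_def)
  qed
  have contg: "continuous_on S g"
    unfolding continuous_on_eq_continuous_within
  proof
    fix w assume w: "w \<in> S"
    show "continuous (at w within S) g"
    proof (cases "w = z0")
      case True
      then show ?thesis using contz0 continuous_at_imp_continuous_at_within by blast
    next
      case False
      have "((\<lambda>w. (uhp_powr q w - uhp_powr q z0) / (w - z0)) \<longlongrightarrow> (uhp_powr q w - uhp_powr q z0) / (w - z0)) (at w within S)"
        using continuous_on_uhp_powr[OF q] w False
        by (intro tendsto_intros) (auto simp: continuous_on_def S_def)
      then have "(g \<longlongrightarrow> (uhp_powr q w - uhp_powr q z0) / (w - z0)) (at w within S)"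
      proof (rule Lim_transform_eventually)
        have "eventually (\<lambda>v. v \<noteq> z0) (at w within S)"
          using False by (metis eventually_at_le eventually_neq_at_within tendsto_imp_eventually_ne tendsto_ident_at)
        then show "\<forall>\<^sub>F v in at w within S. (uhp_powr q v - uhp_powr q z0) / (v - z0) = g v"
          by eventually_elim (simp add: g_def)
      qed
      then show ?thesis using False by (simp add: continuous_within g_def)
    qed
  qed
  have contk: "continuous_on S k"
    unfolding k_def using nz by (intro continuous_intros contg) auto
  have diffk: "k field_differentiable at w" if "w \<in> interior S - {z0}" for w
  proof -
    have w: "Im w > 0" "w \<noteq> z0" using that int by auto
    have "(\<lambda>w. (uhp_powr q w - uhp_powr q z0) / (w - z0) / (w - cnj z0)) field_differentiable at w"
      using w nz[of w] field_differentiable_uhp_powr[OF w(1)]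
      by (intro field_differentiable_divide field_differentiable_diff derivative_intros) (auto simp: S_def)
    then obtain D where "((\<lambda>w. (uhp_powr q w - uhp_powr q z0) / (w - z0) / (w - cnj z0)) has_field_derivative D) (at w)"
      unfolding field_differentiable_def by blast
    then have "(k has_field_derivative D) (at w)"
      by (rule has_field_derivative_transform_within_open[of _ _ _ "- {z0}"])
         (use w in \<open>auto simp: k_def g_def\<close>)
    then show ?thesis unfolding field_differentiable_def by blast
  qed
  let ?L = "linepath (of_real (-R)) (of_real R) :: real \<Rightarrow> complex"
  let ?C = "part_circlepath 0 R 0 pi"
  have LS: "path_image ?L \<subseteq> S"
    unfolding path_image_linepath using closed_segment_subset[OF _ _ conv] by (auto simp: S_def)
  have CS: "path_image ?C \<subseteq> S" and Cn: "\<And>w. w \<in> path_image ?C \<Longrightarrow> norm w = R"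
    using R0 by (auto simp: path_image_part_circlepath' S_def sin_ge_zero Im_exp norm_mult closed_segment_eq_real_ivl)
  have closed: "(k has_contour_integral 0) (?L +++ ?C)"
    by (rule Cauchy_theorem_convex[OF contk conv, of "{z0}"])
      (use diffk LS CS in \<open>auto simp: path_image_join exp_Euler\<close>)
  have kL: "k contour_integrable_on ?L" 
    by (intro contour_integrable_continuous_linepath continuous_on_subset[OF contk]) (use LS in simp)
  have kC: "k contour_integrable_on ?C" 
    by (intro contour_integrable_continuous_part_circlepath continuous_on_subset[OF contk CS])
  have "(k has_contour_integral (contour_integral ?L k + contour_integral ?C k)) (?L +++ ?C)"
    by (intro has_contour_integral_join has_contour_integral_integral kL kC) auto
  then have "contour_integral ?L k + contour_integral ?C k = 0"
    using closed has_contour_integral_unique by blast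
  then have "contour_integral ?L k = - contour_integral ?C k"
    by (simp add: add_eq_0_iff2)
  then have "(k has_contour_integral (- contour_integral ?C k)) ?L"
    using has_contour_integral_integral[OF kL] by simp
  then have 1: "((\<lambda>x. k (of_real x)) has_integral (- contour_integral ?C k)) {-R..R}"
    using has_contour_integral_linepath_Reals_iff[of "of_real (-R)" "of_real R" k] R0 by auto
  have "k (of_real x) = (cpow x q - z0 powr of_real q) / ((of_real x - z0) * (of_real x - cnj z0))" for x
  proof -
    have "complex_of_real x \<noteq> z0" using z0 by auto
    then show ?thesis using z0 by (simp add: k_def g_def cpow_eq_uhp_powr uhp_powr_eq)
  qed
  with 1 have 2: "((\<lambda>x. (cpow x q - z0 powr of_real q) / ((of_real x - z0) * (of_real x - cnj z0))) has_integral (- contour_integral ?C k)) {-R..R}"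
    by simp
  have "norm (contour_integral ?C k) \<le> (R powr q + norm z0 powr q) / (R - norm z0)\<^sup>2 * R * (pi - 0)"
  proof (rule has_contour_integral_bound_part_circlepath[OF has_contour_integral_integral[OF kC]])
    fix w assume "w \<in> path_image ?C"
    then have w: "norm w = R" by (rule Cn)
    then have ne: "w \<noteq> z0" using R by auto
    have a: "R - norm z0 \<le> norm (w - z0)" "R - norm z0 \<le> norm (w - cnj z0)"
      using norm_triangle_ineq2[of w z0] norm_triangle_ineq2[of w "cnj z0"] w by auto
    have "norm (k w) = norm (uhp_powr q w - uhp_powr q z0) / (norm (w - z0) * norm (w - cnj z0))"
      using ne by (simp add: k_def g_def norm_divide norm_mult)
    also have "\<dots> \<le> (R powr q + norm z0 powr q) / ((R - norm z0) * (R - norm z0))"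
    proof (rule frac_le)
      show "norm (uhp_powr q w - uhp_powr q z0) \<le> R powr q + norm z0 powr q"
        using norm_triangle_ineq4[of "uhp_powr q w" "uhp_powr q z0"] unfolding norm_uhp_powr w .
      show "(R - norm z0) * (R - norm z0) \<le> norm (w - z0) * norm (w - cnj z0)"
        by (rule mult_mono[OF a]) (use R in simp_all)
    qed (use R in simp_all)
    finally show "norm (k w) \<le> (R powr q + norm z0 powr q) / (R - norm z0)\<^sup>2"
      by (simp add: power2_eq_square)
  qed (use R0 in auto)
  then have "norm (- contour_integral ?C k) \<le> (R powr q + norm z0 powr q) / (R - norm z0)\<^sup>2 * R * pi"
    by simp
  with 2 show ?thesis by (rule that)
qed

lemma poisson_kernel_eq:
  assumes "\<sigma> > 0"
  shows "complex_of_real (poisson_kernel \<mu> \<sigma> x) =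
    of_real \<sigma> / ((of_real x - Complex \<mu> \<sigma>) * (of_real x - cnj (Complex \<mu> \<sigma>)))"
proof -
  have "(of_real x - Complex \<mu> \<sigma>) * (of_real x - cnj (Complex \<mu> \<sigma>)) = complex_of_real ((x - \<mu>)\<^sup>2 + \<sigma>\<^sup>2)"
    by (simp add: complex_eq_iff power2_eq_square algebra_simps)
  then show ?thesis unfolding poisson_kernel_def by simp
qed

lemma norm_cpow_le: "0 \<le> q \<Longrightarrow> norm (cpow x q) \<le> 1 * (1 + \<bar>x\<bar>) powr q"
  unfolding norm_cpow by (simp add: powr_mono2)

lemma integrable_poisson_cpow:
  assumes "0 < q" "q < 1" "\<sigma> > 0"
  shows "integrable lborel (\<lambda>x. poisson_kernel \<mu> \<sigma> x *\<^sub>R cpow x q)"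
  by (rule integrable_poisson_kernel[OF assms(3,2) _ norm_cpow_le]) (use assms in auto)

text \<open>
  The bound for the half disc of radius \<open>n\<close> is of order \<open>n\<^sup>q\<^sup>-\<^sup>1\<close>, hence the integral of
  \<open>poisson_kernel \<mu> \<sigma> x *\<^sub>R (cpow x q - z0\<^sup>q)\<close> over the whole line vanishes.
\<close>

lemma integral_poisson_cpow:
  assumes q: "0 < q" "q < 1" and s: "\<sigma> > 0"
  shows "(LINT x|lborel. poisson_kernel \<mu> \<sigma> x *\<^sub>R cpow x q) = of_real pi * Complex \<mu> \<sigma> powr of_real q"
proof -
  define z0 where "z0 = Complex \<mu> \<sigma>"
  define h where "h x = poisson_kernel \<mu> \<sigma> x *\<^sub>R (cpow x q - z0 powr of_real q)" for x
  have ci: "integrable lborel (\<lambda>x. poisson_kernel \<mu> \<sigma> x *\<^sub>R (z0 powr of_real q))"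
    by (rule integrable_poisson_kernel[OF s, of 0]) (auto intro!: order_refl)
  have hi: "integrable lborel h"
    unfolding h_def scaleR_diff_right
    by (intro Bochner_Integration.integrable_diff integrable_poisson_cpow q s ci)
  have lim1: "(\<lambda>n. LINT x|lborel. indicator {- real n..real n} x *\<^sub>R h x) \<longlonglongrightarrow> (LINT x|lborel. h x)"
  proof (rule integral_dominated_convergence[OF _ _ integrable_norm[OF hi]])
    show "AE x in lborel. (\<lambda>n. indicat_real {- real n..real n} x *\<^sub>R h x) \<longlonglongrightarrow> h x"
    proof (rule AE_I2)
      fix x :: real
      obtain N :: nat where N: "\<bar>x\<bar> \<le> real N" using real_arch_simple by blast
      have "eventually (\<lambda>n. indicat_real {- real n..real n} x *\<^sub>R h x = h x) sequentially"
        using eventually_ge_at_top[of N] by eventually_elim (use N in \<open>auto simp: indicator_def\<close>)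
      then show "(\<lambda>n. indicat_real {- real n..real n} x *\<^sub>R h x) \<longlonglongrightarrow> h x"
        by (simp add: tendsto_eventually)
    qed
  qed (use hi in \<open>auto simp: indicator_def\<close>)
  have lim0: "(\<lambda>n. LINT x|lborel. indicator {- real n..real n} x *\<^sub>R h x) \<longlonglongrightarrow> 0"
  proof (rule Lim_null_comparison)
    define c where "c = norm z0"
    show "\<forall>\<^sub>F n in sequentially. norm (LINT x|lborel. indicator {- real n..real n} x *\<^sub>R h x)
       \<le> \<sigma> * ((real n powr q + c powr q) / (real n - c)\<^sup>2 * real n * pi)"
    proof -
      obtain N :: nat where N: "c < real N" using reals_Archimedean2 by blast
      show ?thesis using eventually_ge_at_top[of N]
      proof eventually_elim
        case (elim n)
        then have n: "real n > norm z0" using N by (simp add: c_def)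
        obtain I where I: "((\<lambda>x. (cpow x q - z0 powr of_real q) / ((of_real x - z0) * (of_real x - cnj z0))) has_integral I) {-real n..real n}"
           "norm I \<le> (real n powr q + norm z0 powr q) / (real n - norm z0)\<^sup>2 * real n * pi"
          using half_disc_integral_bound[OF q(1) _ n] s by (auto simp: z0_def)
        have "((\<lambda>x. of_real \<sigma> * ((cpow x q - z0 powr of_real q) / ((of_real x - z0) * (of_real x - cnj z0)))) has_integral of_real \<sigma> * I) {-real n..real n}"
          by (intro has_integral_mult_right I)
        then have "(h has_integral of_real \<sigma> * I) {-real n..real n}"
          by (simp add: h_def[abs_def] scaleR_conv_of_real poisson_kernel_eq[OF s] z0_def)
        moreover have "set_integrable lebesgue {-real n..real n} h"
          using hi by (simp add: set_integrable_def integrable_completion integrable_mult_indicator)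
        ultimately have "(LINT x:{-real n..real n}|lebesgue. h x) = of_real \<sigma> * I"
          by (simp add: set_lebesgue_integral_eq_integral(2) integral_unique)
        then have "(LINT x|lborel. indicator {- real n..real n} x *\<^sub>R h x) = of_real \<sigma> * I"
          using hi by (simp add: set_lebesgue_integral_def integral_completion)
        then have "norm (LINT x|lborel. indicator {- real n..real n} x *\<^sub>R h x) = \<sigma> * norm I"
            using s by (simp add: norm_mult)
          also have "\<dots> \<le> \<sigma> * ((real n powr q + c powr q) / (real n - c)\<^sup>2 * real n * pi)"
            using I(2) s unfolding c_def by (intro mult_left_mono) auto
          finally show ?case .
      qed
    qed
    show "(\<lambda>n. \<sigma> * ((real n powr q + c powr q) / (real n - c)\<^sup>2 * real n * pi)) \<longlonglongrightarrow> 0"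
      using q by real_asymp
  qed
  have "0 = (LINT x|lborel. h x)" using LIMSEQ_unique[OF lim0 lim1] .
  also have "\<dots> = (LINT x|lborel. poisson_kernel \<mu> \<sigma> x *\<^sub>R cpow x q) - (LINT x|lborel. poisson_kernel \<mu> \<sigma> x *\<^sub>R (z0 powr of_real q))"
    unfolding h_def scaleR_diff_right
    by (intro Bochner_Integration.integral_diff integrable_poisson_cpow q s ci)
  also have "(LINT x|lborel. poisson_kernel \<mu> \<sigma> x *\<^sub>R (z0 powr of_real q)) = of_real pi * z0 powr of_real q"
    using integral_poisson_kernel[OF s, of \<mu>] integrable_poisson_kernel[OF s, of 0 "\<lambda>_. 1::real" 1 \<mu>]
    by (simp add: integral_scaleR_left scaleR_conv_of_real)
  finally show ?thesis by (simp add: z0_def)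
qed


section \<open>Weak convergence from characteristic functions\<close>

text \<open>
  Trigonometric polynomials with arbitrary real frequencies. They form an algebra whose integrals
  are linear combinations of values of the characteristic function, and unlike those with integer
  frequencies they separate all points.
\<close>

inductive trig_poly :: "('b::euclidean_space \<Rightarrow> complex) \<Rightarrow> bool" where
  exp: "trig_poly (\<lambda>x. exp (\<i> * complex_of_real (u \<bullet> x)))"
| add: "trig_poly f \<Longrightarrow> trig_poly g \<Longrightarrow> trig_poly (\<lambda>x. f x + g x)"
| scale: "trig_poly f \<Longrightarrow> trig_poly (\<lambda>x. c * f x)"

lemma trig_poly_const: "trig_poly (\<lambda>_. c)"
  using trig_poly.scale[OF trig_poly.exp[of 0], of c] by simp

lemma trig_poly_mult:
  assumes "trig_poly f" "trig_poly g"
  shows "trig_poly (\<lambda>x. f x * g x)"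
  using assms(1)
proof induction
  case (exp u)
  show ?case using assms(2)
  proof induction
    case (exp v)
    show ?case using trig_poly.exp[of "u + v"]
      by (simp add: exp_add[symmetric] inner_add_left algebra_simps)
  next
    case (add f g)
    then show ?case using trig_poly.add by (simp add: distrib_left)
  next
    case (scale f c)
    then show ?case using trig_poly.scale[of _ c] by (simp add: mult.left_commute)
  qed
next
  case (add f g)
  then show ?case using trig_poly.add by (simp add: distrib_right)
next
  case (scale f c)
  then show ?case using trig_poly.scale[of _ c] by (simp add: mult.assoc)
qed

lemma trig_poly_bounded: "trig_poly f \<Longrightarrow> \<exists>C. \<forall>x. norm (f x) \<le> C"
proof (induction rule: trig_poly.induct)
  case (exp u)
  show ?case by (auto intro!: exI[of _ 1])
next
  case (add f g)
  then obtain C D where "\<forall>x. norm (f x) \<le> C" "\<forall>x. norm (g x) \<le> D" by auto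
  then show ?case by (intro exI[of _ "C + D"]) (auto intro: norm_triangle_le add_mono)
next
  case (scale f c)
  then obtain C where "\<forall>x. norm (f x) \<le> C" by auto
  then show ?case by (intro exI[of _ "norm c * C"]) (auto simp: norm_mult intro: mult_left_mono)
qed

lemma trig_poly_continuous: "trig_poly f \<Longrightarrow> continuous_on A f"
  by (induction rule: trig_poly.induct) (auto intro!: continuous_intros)

lemma trig_poly_integrable:
  assumes "trig_poly f" "finite_measure N" "sets N = sets borel"
  shows "integrable N f"
proof -
  obtain C where "\<forall>x. norm (f x) \<le> C" using trig_poly_bounded[OF assms(1)] by blast
  moreover have "f \<in> borel_measurable N"
    using borel_measurable_continuous_onI[OF trig_poly_continuous[OF assms(1)]]
    by (simp only: measurable_cong_sets[OF assms(3) refl])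
  ultimately show ?thesis
    by (intro finite_measure.integrable_const_bound[OF assms(2), of _ C]) auto
qed

lemma trig_poly_integral_tendsto:
  assumes "trig_poly f"
    and "\<And>n. finite_measure (\<nu> n)" "\<And>n. sets (\<nu> n) = sets borel"
    and "finite_measure N" "sets N = sets borel"
    and char: "\<And>u. (\<lambda>n. LINT x|\<nu> n. exp (\<i> * complex_of_real (u \<bullet> x))) \<longlonglongrightarrow>
                   (LINT x|N. exp (\<i> * complex_of_real (u \<bullet> x)))"
  shows "(\<lambda>n. LINT x|\<nu> n. f x) \<longlonglongrightarrow> (LINT x|N. f x)"
  using assms(1)
proof induction
  case (exp u)
  show ?case by (rule char)
next
  case (add f g)
  then show ?case
    using trig_poly_integrable[OF _ assms(2,3)] trig_poly_integrable[OF _ assms(4,5)]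
    by (simp add: tendsto_add)
next
  case (scale f c)
  then show ?case by (simp add: tendsto_mult_left)
qed

lemma trig_poly_polynomial:
  fixes q :: "real \<Rightarrow> real"
  assumes "real_polynomial_function q" and p: "trig_poly (\<lambda>x. complex_of_real (p x))"
  shows "trig_poly (\<lambda>x. complex_of_real (q (p x)))"
  using assms(1)
proof induction
  case (linear h)
  have "h y = h 1 * y" for y
    using linear_scale[OF bounded_linear.linear[OF linear], of y 1] by simp
  then have "(\<lambda>x. complex_of_real (h (p x))) = (\<lambda>x. complex_of_real (h 1) * complex_of_real (p x))"
    by (metis (no_types) of_real_mult)
  then show ?case using trig_poly.scale[OF p] by simp
qed (auto intro: trig_poly_const trig_poly.add trig_poly_mult)

lemma trig_poly_cos: "trig_poly (\<lambda>x. complex_of_real (cos (u \<bullet> x)))"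
proof -
  have "complex_of_real (cos (u \<bullet> x)) =
      (1/2) * exp (\<i> * complex_of_real (u \<bullet> x)) + (1/2) * exp (\<i> * complex_of_real ((- u) \<bullet> x))" for x
    by (simp add: complex_eq_iff Re_exp Im_exp)
  then show ?thesis by (simp only:) (intro trig_poly.intros)
qed

lemma trig_poly_sin: "trig_poly (\<lambda>x. complex_of_real (sin (u \<bullet> x)))"
proof -
  have "complex_of_real (sin (u \<bullet> x)) =
      (- \<i>/2) * exp (\<i> * complex_of_real (u \<bullet> x)) + (\<i>/2) * exp (\<i> * complex_of_real ((- u) \<bullet> x))" for x
    by (simp add: complex_eq_iff Re_exp Im_exp)
  then show ?thesis by (simp only:) (intro trig_poly.intros)
qed

text \<open>
  Along the direction \<open>x - y\<close> the frequency can be chosen such that the phases of \<open>x\<close> and \<open>y\<close>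
  differ by exactly \<open>\<pi>\<close>.
\<close>

lemma trig_poly_separates:
  fixes x y :: "'b::euclidean_space"
  assumes "x \<noteq> y"
  shows "\<exists>p. trig_poly (\<lambda>x. complex_of_real (p x)) \<and> p x \<noteq> p y"
proof (rule ccontr)
  assume "\<not> ?thesis"
  then have eq: "p x = p y" if "trig_poly (\<lambda>x. complex_of_real (p x))" for p using that by blast
  define u where "u = (pi / ((x - y) \<bullet> (x - y))) *\<^sub>R (x - y)"
  have "(x - y) \<bullet> (x - y) \<noteq> 0" using assms by simp
  then have "u \<bullet> (x - y) = pi" by (simp add: u_def)
  then have u: "u \<bullet> x - u \<bullet> y = pi" by (simp only: inner_diff_right)
  have c: "cos (u \<bullet> x) = cos (u \<bullet> y)" by (rule eq) (rule trig_poly_cos)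
  have s: "sin (u \<bullet> x) = sin (u \<bullet> y)" by (rule eq) (rule trig_poly_sin)
  have "cos (u \<bullet> x - u \<bullet> y) = 1" using c s by (simp add: cos_diff power2_eq_square[symmetric])
  then show False using u by simp
qed

text \<open>
  Stone--Weierstrass approximates \<open>f\<close> on the compact set only, and the approximant may be large
  elsewhere. As it is bounded, it can be composed with an ordinary polynomial that is close, on
  its range, to truncation at \<open>\<plusminus>C\<close>: the result is again a trigonometric polynomial, still close
  to \<open>f\<close> on the compact set, and almost as small as \<open>f\<close> everywhere.
\<close>

lemma trig_poly_approx:
  fixes f :: "'b::euclidean_space \<Rightarrow> real"
  assumes f: "continuous_on UNIV f" "\<And>x. \<bar>f x\<bar> \<le> C" and S: "compact S" and e: "e > 0"
  obtains p where "trig_poly (\<lambda>x. complex_of_real (p x))"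
    "\<And>x. x \<in> S \<Longrightarrow> \<bar>f x - p x\<bar> \<le> e" "\<And>x. \<bar>p x\<bar> \<le> C + e"
proof -
  define R where "R = {p. trig_poly (\<lambda>x::'b. complex_of_real (p x))}"
  interpret R: function_ring_on R S
  proof
    show "continuous_on S p" if "p \<in> R" for p
      using continuous_on_Re[OF trig_poly_continuous] that unfolding R_def by fastforce
    show "\<exists>p\<in>R. p x \<noteq> p y" if "x \<noteq> y" for x y
      using trig_poly_separates[OF that] by (auto simp: R_def)
  qed (use S in \<open>auto simp: R_def intro: trig_poly.add trig_poly_mult trig_poly_const\<close>)
  obtain p0 where p0: "p0 \<in> R" "\<And>x. x \<in> S \<Longrightarrow> \<bar>f x - p0 x\<bar> < e / 2"
    using R.Stone_Weierstrass_basic[of f "e / 2"] f(1) e continuous_on_subset by fastforce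
  obtain P where P: "\<And>x. \<bar>p0 x\<bar> \<le> P"
    using trig_poly_bounded[of "\<lambda>x. complex_of_real (p0 x)"] p0(1) by (auto simp: R_def)
  define clamp where "clamp s = max (- C) (min C s)" for s :: real
  have C: "C \<ge> 0" using f(2)[of undefined] by linarith
  have "continuous_on {- P..P} clamp" unfolding clamp_def by (intro continuous_intros)
  then obtain q where q: "real_polynomial_function q" "\<And>s. s \<in> {-P..P} \<Longrightarrow> \<bar>clamp s - q s\<bar> < e / 2"
    using Stone_Weierstrass_real_polynomial_function[of "{-P..P}" clamp "e / 2"] e by auto
  have qp: "\<bar>clamp (p0 x) - q (p0 x)\<bar> < e / 2" for x
    using q(2)[of "p0 x"] P[of x] by (simp add: abs_le_iff)
  show ?thesis
  proof (rule that[of "\<lambda>x. q (p0 x)"])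
    show "trig_poly (\<lambda>x. complex_of_real (q (p0 x)))"
      using trig_poly_polynomial[OF q(1)] p0(1) by (simp add: R_def)
    show "\<bar>q (p0 x)\<bar> \<le> C + e" for x
      using qp[of x] C e unfolding clamp_def by linarith
    show "\<bar>f x - q (p0 x)\<bar> \<le> e" if "x \<in> S" for x
      using qp[of x] p0(2)[OF that] f(2)[of x] e unfolding clamp_def by linarith
  qed
qed

lemma (in prob_space) tight_single:
  fixes Y :: "'a \<Rightarrow> 'b::real_normed_vector"
  assumes Y[measurable]: "Y \<in> borel_measurable M" and e: "e > 0"
  shows "\<exists>K. measure M {\<omega> \<in> space M. norm (Y \<omega>) > K} \<le> e"
proof -
  have "(\<lambda>k. measure M {\<omega> \<in> space M. norm (Y \<omega>) > real k}) \<longlonglongrightarrow> measure M (\<Inter>k. {\<omega> \<in> space M. norm (Y \<omega>) > real k})"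
    by (rule finite_Lim_measure_decseq) (auto simp: decseq_def)
  also have "(\<Inter>k. {\<omega> \<in> space M. norm (Y \<omega>) > real k}) = {}"
    using real_arch_simple by (auto simp: not_less, meson not_less)
  finally have "(\<lambda>k. measure M {\<omega> \<in> space M. norm (Y \<omega>) > real k}) \<longlonglongrightarrow> 0" by simp
  from order_tendstoD(2)[OF this e] show ?thesis
    unfolding eventually_sequentially by (meson order_refl less_imp_le)
qed

text \<open>
  Replace \<open>f\<close> by a trigonometric polynomial close to it on a large ball; tightness makes the
  contribution outside the ball small uniformly in \<open>n\<close>, and the integrals of the trigonometric
  polynomial converge by assumption.
\<close>

theorem weakly_converges_char_tight:
  fixes \<nu> :: "nat \<Rightarrow> 'b::euclidean_space measure"
  assumes prob: "\<And>n. prob_space (\<nu> n)" "\<And>n. sets (\<nu> n) = sets borel"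
    and N: "prob_space N" "sets N = sets borel"
    and tight: "\<And>e. e > 0 \<Longrightarrow> \<exists>K. \<forall>n. measure (\<nu> n) {x. norm x > K} \<le> e"
    and char: "\<And>u. (\<lambda>n. LINT x|\<nu> n. exp (\<i> * complex_of_real (u \<bullet> x))) \<longlonglongrightarrow>
                   (LINT x|N. exp (\<i> * complex_of_real (u \<bullet> x)))"
  shows "weakly_converges \<nu> N"
  unfolding weakly_converges_def
proof (intro allI impI)
  fix f :: "'b \<Rightarrow> real" assume "continuous_on UNIV f \<and> bounded (range f)"
  then obtain C where f: "continuous_on UNIV f" and C: "\<And>x. \<bar>f x\<bar> \<le> C"
    by (auto simp: bounded_iff)
  have C0: "C \<ge> 0" using C[of undefined] by linarith
  have fm: "f \<in> borel_measurable borel" using f by (rule borel_measurable_continuous_onI)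
  show "(\<lambda>n. LINT x|\<nu> n. f x) \<longlonglongrightarrow> (LINT x|N. f x)"
    unfolding tendsto_iff
  proof (intro allI impI)
    fix e0 :: real assume e0: "e0 > 0"
    \<comment> \<open>Each of the two replacements costs \<open>e + (2 C + e) e\<close>, the convergence of the integrals of
      \<open>p\<close> another \<open>e\<close>; this choice keeps the total below \<open>e0\<close>.\<close>
    define e where "e = min 1 (e0 / (4 * (2 * C + 2)))"
    have e: "0 < e" "e \<le> 1" using e0 C0 by (auto simp: e_def)
    have e_le: "e * (4 * (2 * C + 2)) \<le> e0"
    proof -
      have "e \<le> e0 / (4 * (2 * C + 2))" by (simp add: e_def)
      then show ?thesis using C0 by (subst (asm) pos_le_divide_eq) auto
    qed
    obtain K1 where K1: "\<And>n. measure (\<nu> n) {x. norm x > K1} \<le> e" using tight[OF e(1)] by blast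
    obtain K2 where K2: "measure N {x. norm x > K2} \<le> e"
      using prob_space.tight_single[OF N(1), of "\<lambda>x. x" e] e N(2) 
      by (auto simp: measurable_ident_sets sets_eq_imp_space_eq[OF N(2)])
    define K where "K = max K1 K2"
    obtain p where p: "trig_poly (\<lambda>x. complex_of_real (p x))"
      "\<And>x. x \<in> cball 0 K \<Longrightarrow> \<bar>f x - p x\<bar> \<le> e" "\<And>x. \<bar>p x\<bar> \<le> C + e"
      using trig_poly_approx[OF f C compact_cball e(1)] by blast
    have pm: "p \<in> borel_measurable borel"
      using borel_measurable_continuous_onI[OF continuous_on_Re[OF trig_poly_continuous[OF p(1)]]] by simp
    have close: "\<bar>(LINT x|Q. f x) - (LINT x|Q. p x)\<bar> \<le> e + (2 * C + e) * e"
      if Q: "prob_space Q" "sets Q = sets borel" "measure Q {x. norm x > K} \<le> e" for Q :: "'b measure"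
    proof -
      interpret Q: prob_space Q by fact
      have [measurable_cong]: "sets Q = sets borel" by fact
      note [measurable] = fm pm
      have spQ: "space Q = UNIV" using sets_eq_imp_space_eq[OF Q(2)] by simp
      have fi: "integrable Q f" by (rule Q.integrable_const_bound[of _ C]) (use C in auto)
      have pi: "integrable Q p" by (rule Q.integrable_const_bound[of _ "C + e"]) (use p in auto)
      have ii: "integrable Q (\<lambda>x. e + (2 * C + e) * indicator {x. norm x > K} x :: real)"
        using C0 e by (intro Q.integrable_const_bound[of _ "2 * e + 2 * C"] AE_I2) (auto simp: indicator_def)
      have "\<bar>(LINT x|Q. f x) - (LINT x|Q. p x)\<bar> = \<bar>LINT x|Q. f x - p x\<bar>"
        by (simp add: fi pi)
      also have "\<dots> \<le> (LINT x|Q. \<bar>f x - p x\<bar>)"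
        by (rule integral_abs_bound)
      also have "\<dots> \<le> (LINT x|Q. e + (2 * C + e) * indicator {x. norm x > K} x)"
      proof (rule integral_mono[OF _ ii])
        show "integrable Q (\<lambda>x. \<bar>f x - p x\<bar>)" using fi pi by auto
        show "\<bar>f x - p x\<bar> \<le> e + (2 * C + e) * indicator {x. norm x > K} x" for x
        proof (cases "norm x > K")
          case True
          then show ?thesis using C[of x] p(3)[of x] e by simp
        next
          case False
          then show ?thesis using p(2)[of x] by simp
        qed
      qed
      also have "\<dots> = e + (2 * C + e) * measure Q {x. norm x > K}"
        by (subst Bochner_Integration.integral_add)
           (auto simp: Q.prob_space[unfolded spQ] spQ intro!: Q.integrable_const_bound[of _ "1"])
      also have "\<dots> \<le> e + (2 * C + e) * e"
        using Q(3) C0 e by (intro add_left_mono mult_left_mono) auto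
      finally show ?thesis .
    qed
    have mono: "measure Q {x. norm x > K} \<le> e"
      if Q: "prob_space Q" "sets Q = sets borel" "measure Q {x. norm x > K'} \<le> e" "K' \<le> K" for Q :: "'b measure" and K'
    proof -
      interpret Q: prob_space Q by fact
      have "measure Q {x. norm x > K} \<le> measure Q {x. norm x > K'}"
        by (rule Q.finite_measure_mono) (use Q in auto)
      then show ?thesis using Q(3) by simp
    qed
    have cn: "\<bar>(LINT x|\<nu> n. f x) - (LINT x|\<nu> n. p x)\<bar> \<le> e + (2 * C + e) * e" for n
      by (rule close[OF prob mono[OF prob K1]]) (simp add: K_def)
    have cN: "\<bar>(LINT x|N. f x) - (LINT x|N. p x)\<bar> \<le> e + (2 * C + e) * e"
      by (rule close[OF N mono[OF N K2]]) (simp add: K_def)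
    have "(\<lambda>n. LINT x|\<nu> n. complex_of_real (p x)) \<longlonglongrightarrow> (LINT x|N. complex_of_real (p x))"
      by (rule trig_poly_integral_tendsto[OF p(1)])
         (use prob N char in \<open>auto simp: prob_space.finite_measure\<close>)
    then have "(\<lambda>n. LINT x|\<nu> n. p x) \<longlonglongrightarrow> (LINT x|N. p x)"
      by (simp add: tendsto_of_real_iff)
    then have ev: "\<forall>\<^sub>F n in sequentially. dist (LINT x|\<nu> n. p x) (LINT x|N. p x) < e"
      using e(1) unfolding tendsto_iff by blast
    have "e * e \<le> e" using e mult_left_le by (simp add: mult_left_le)
    then have lt: "3 * e + 2 * ((2 * C + e) * e) < e * (4 * (2 * C + 2))"
    proof -
      have "C * e \<ge> 0" using C0 e by simp
      moreover have "3 * e + 2 * ((2 * C + e) * e) = 3 * e + 4 * (C * e) + 2 * (e * e)"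
        "e * (4 * (2 * C + 2)) = 8 * (C * e) + 8 * e" by algebra+
      ultimately show ?thesis using \<open>e * e \<le> e\<close> e(1) by linarith
    qed
    show "\<forall>\<^sub>F n in sequentially. dist (LINT x|\<nu> n. f x) (LINT x|N. f x) < e0"
      using ev
    proof eventually_elim
      case (elim n)
      then show ?case using cn[of n] cN e_le lt unfolding dist_real_def by linarith
    qed
  qed
qed


section \<open>Bivariate normal distributions\<close>

text \<open>
  The image of a pair of independent standard normal variables under a Cholesky factor
  \<open>(p, 0; r, s)\<close> of the matrix, which exists also in the singular case.
\<close>

lemma bivariate_normal_exists:
  fixes S :: "real ^ 2 ^ 2"
  assumes "nonneg_definite S"
  shows "\<exists>N. normal_distribution 0 S N"
proof -
  define a b c where "a = S $ 1 $ 1" and "b = S $ 1 $ 2" and "c = S $ 2 $ 2"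
  have "S $ 2 $ 1 = transpose S $ 1 $ 2" by (simp add: transpose_def)
  then have b': "S $ 2 $ 1 = b" using assms by (simp add: nonneg_definite_def b_def)
  have quad: "u \<bullet> (S *v u) = a * (u$1)\<^sup>2 + 2 * b * (u$1) * (u$2) + c * (u$2)\<^sup>2" for u
    by (simp add: inner_vec_def matrix_vector_mult_def sum_2 b' a_def[symmetric] b_def[symmetric] c_def[symmetric])
       (simp add: algebra_simps power2_eq_square)
  have nonneg: "0 \<le> a * x\<^sup>2 + 2 * b * x * y + c * y\<^sup>2" for x y
  proof -
    have "0 \<le> vector [x, y] \<bullet> (S *v vector [x, y])"
      using assms unfolding nonneg_definite_def by blast
    then show ?thesis by (simp only: quad vector_2)
  qed
  have "a \<ge> 0" "c \<ge> 0" using nonneg[of 1 0] nonneg[of 0 1] by auto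
  have "\<exists>p r s. a = p\<^sup>2 \<and> b = p * r \<and> c = r\<^sup>2 + s\<^sup>2"
  proof (cases "a = 0")
    case True
    have "b = 0"
    proof (rule ccontr)
      assume "b \<noteq> 0"
      then have "a * (- (c + 1) / (2 * b))\<^sup>2 + 2 * b * (- (c + 1) / (2 * b)) * 1 + c * 1\<^sup>2 = -1"
        using True by (simp add: field_simps)
      then show False using nonneg[of "- (c + 1) / (2 * b)" 1] by linarith
    qed
    then show ?thesis using True \<open>c \<ge> 0\<close>
      by (intro exI[of _ 0] exI[of _ 0] exI[of _ "sqrt c"]) auto
  next
    case False
    then have a: "a > 0" using \<open>a \<ge> 0\<close> by simp
    have "0 \<le> a * (c * a - b\<^sup>2)" using nonneg[of "- b" a] by (simp add: algebra_simps power2_eq_square)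
    then have "c - b\<^sup>2 / a \<ge> 0" using a by (simp add: field_simps zero_le_mult_iff)
    then show ?thesis using a
      by (intro exI[of _ "sqrt a"] exI[of _ "b / sqrt a"] exI[of _ "sqrt (c - b\<^sup>2 / a)"])
         (auto simp: power_divide)
  qed
  then obtain p r s where prs: "a = p\<^sup>2" "b = p * r" "c = r\<^sup>2 + s\<^sup>2" by blast
  let ?G = "std_normal_distribution"
  interpret G: prob_space ?G by (rule prob_space_normal_density) simp
  interpret GG: pair_prob_space ?G ?G ..
  define h :: "real \<times> real \<Rightarrow> real ^ 2" where "h = (\<lambda>(x, y). (p * x) *\<^sub>R axis 1 1 + (r * x + s * y) *\<^sub>R axis 2 1)"
  have [measurable]: "h \<in> borel_measurable (?G \<Otimes>\<^sub>M ?G)" unfolding h_def by measurable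
  define N where "N = distr (?G \<Otimes>\<^sub>M ?G) borel h"
  have "prob_space N" unfolding N_def by (rule GG.prob_space_distr) measurable
  moreover have "(LINT x|N. exp (\<i> * complex_of_real (u \<bullet> x))) = exp (- complex_of_real (u \<bullet> (S *v u)) / 2)" for u
  proof -
    define \<alpha> \<beta> where "\<alpha> = u$1 * p + u$2 * r" and "\<beta> = u$2 * s"
    have uh: "u \<bullet> h z = \<alpha> * fst z + \<beta> * snd z" for z
      by (cases z) (simp add: h_def inner_add_right inner_axis \<alpha>_def \<beta>_def algebra_simps)
    have "(LINT x|N. exp (\<i> * complex_of_real (u \<bullet> x))) = (LINT z|(?G \<Otimes>\<^sub>M ?G). exp (\<i> * complex_of_real (u \<bullet> h z)))"
      unfolding N_def by (subst integral_distr) auto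
    also have "\<dots> = (LINT z|(?G \<Otimes>\<^sub>M ?G). iexp (\<alpha> * fst z) * iexp (\<beta> * snd z))"
      unfolding uh by (simp add: exp_add[symmetric] algebra_simps)
    also have "\<dots> = (LINT x|?G. LINT y|?G. iexp (\<alpha> * x) * iexp (\<beta> * y))"
      by (subst GG.integral_fst'[symmetric])
         (auto intro!: GG.integrable_const_bound[of _ 1] simp: norm_mult)
    also have "\<dots> = (LINT x|?G. iexp (\<alpha> * x)) * (LINT y|?G. iexp (\<beta> * y))"
      by simp
    also have "\<dots> = char ?G \<alpha> * char ?G \<beta>" by (simp add: char_def)
    also have "\<dots> = complex_of_real (exp (- (\<alpha>\<^sup>2 + \<beta>\<^sup>2) / 2))"
      unfolding char_std_normal_distribution by (simp only: of_real_mult[symmetric] exp_add[symmetric] add_divide_distrib minus_add_distrib minus_divide_left)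
    also have "\<alpha>\<^sup>2 + \<beta>\<^sup>2 = u \<bullet> (S *v u)"
      unfolding quad prs \<alpha>_def \<beta>_def by (simp add: algebra_simps power2_eq_square)
    finally show ?thesis by (simp add: exp_of_real[symmetric] del: exp_of_real)
  qed
  ultimately show ?thesis unfolding normal_distribution_def
    by (intro exI[of _ N]) (simp add: N_def)
qed


section \<open>Independent identically distributed square-integrable vectors\<close>

locale iid_square_integrable = prob_space M for M :: "'a measure" +
  fixes Z :: "nat \<Rightarrow> 'a \<Rightarrow> 'b::euclidean_space"
  assumes indep: "indep_vars (\<lambda>_. borel) Z UNIV"
    and ident: "\<And>i. distr M borel (Z i) = distr M borel (Z 0)"
    and square_integrable: "integrable M (\<lambda>\<omega>. (norm (Z 0 \<omega>))\<^sup>2)"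

lemma iid_square_integrable_image:
  fixes g :: "'x::topological_space \<Rightarrow> 'b::euclidean_space"
  assumes "prob_space M"
    and indep: "prob_space.indep_vars M (\<lambda>_. borel) X UNIV"
    and ident: "\<And>i. distr M borel (X i) = distr M borel (X 0)"
    and g[measurable]: "g \<in> borel_measurable borel"
    and int: "integrable M (\<lambda>\<omega>. (norm (g (X 0 \<omega>)))\<^sup>2)"
  shows "iid_square_integrable M (\<lambda>i \<omega>. g (X i \<omega>))"
proof -
  interpret prob_space M by fact
  have [measurable]: "X i \<in> borel_measurable M" for i using indep by (auto simp: indep_vars_def)
  have "distr M borel (\<lambda>\<omega>. g (X i \<omega>)) = distr M borel (\<lambda>\<omega>. g (X 0 \<omega>))" for i
  proof -
    have "distr M borel (\<lambda>\<omega>. g (X i \<omega>)) = distr (distr M borel (X i)) borel g" for i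
      by (subst distr_distr) (auto simp: comp_def)
    then show ?thesis using ident[of i] by metis
  qed
  moreover have "indep_vars (\<lambda>_. borel) (\<lambda>i \<omega>. g (X i \<omega>)) UNIV"
    by (rule indep_vars_compose2[OF indep]) simp
  ultimately show ?thesis using int by unfold_locales
qed

context iid_square_integrable
begin

definition mean :: 'b where "mean = expectation (Z 0)"

definition average :: "nat \<Rightarrow> 'a \<Rightarrow> 'b" where
  "average n \<omega> = (\<Sum>j<n. Z j \<omega>) /\<^sub>R real n"

definition dispersion :: real where
  "dispersion = expectation (\<lambda>\<omega>. (norm (Z 0 \<omega> - mean))\<^sup>2)"

lemma measurable_Z [measurable]: "Z i \<in> borel_measurable M"
  using indep by (auto simp: indep_vars_def)

lemma measurable_average [measurable]: "average n \<in> borel_measurable M"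
  unfolding average_def by measurable

lemma integrable_transfer:
  fixes g :: "'b \<Rightarrow> 'c::{banach, second_countable_topology}"
  assumes g: "g \<in> borel_measurable borel" and "integrable M (\<lambda>\<omega>. g (Z 0 \<omega>))"
  shows "integrable M (\<lambda>\<omega>. g (Z i \<omega>))"
  using assms integrable_distr_eq[OF measurable_Z g, of i] integrable_distr_eq[OF measurable_Z g, of 0] ident[of i]
  by simp

lemma expectation_transfer:
  fixes g :: "'b \<Rightarrow> 'c::{banach, second_countable_topology}"
  assumes g: "g \<in> borel_measurable borel"
  shows "expectation (\<lambda>\<omega>. g (Z i \<omega>)) = expectation (\<lambda>\<omega>. g (Z 0 \<omega>))"
  using integral_distr[OF measurable_Z g, of i] integral_distr[OF measurable_Z g, of 0] ident[of i]
  by simp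

text \<open>
  The growth condition covers affine maps as well as the positive part, which is all that is needed
  to reduce vectors to real variables, real variables to centred ones, and to nonnegative ones.
\<close>

lemma image:
  fixes g :: "'b \<Rightarrow> 'c::euclidean_space"
  assumes g[measurable]: "g \<in> borel_measurable borel" and C: "\<And>z. norm (g z) \<le> C * (1 + norm z)"
  shows "iid_square_integrable M (\<lambda>i \<omega>. g (Z i \<omega>))"
proof (rule iid_square_integrable_image[OF prob_space_axioms indep ident g])
  have bound: "(norm (g z))\<^sup>2 \<le> 2 * C\<^sup>2 + 2 * C\<^sup>2 * (norm z)\<^sup>2" for z
  proof -
    have "(norm (g z))\<^sup>2 \<le> (C * (1 + norm z))\<^sup>2" using C by (intro power_mono) auto
    also have "\<dots> = C\<^sup>2 * (1 + norm z)\<^sup>2" by (simp add: power_mult_distrib)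
    also have "\<dots> \<le> C\<^sup>2 * (2 + 2 * (norm z)\<^sup>2)"
      using sum_squares_bound[of 1 "norm z"] by (intro mult_left_mono) (auto simp: power2_sum)
    finally show ?thesis by (simp add: algebra_simps)
  qed
  show "integrable M (\<lambda>\<omega>. (norm (g (Z 0 \<omega>)))\<^sup>2)"
    by (rule Bochner_Integration.integrable_bound[of M "\<lambda>\<omega>. 2 * C\<^sup>2 + 2 * C\<^sup>2 * (norm (Z 0 \<omega>))\<^sup>2"])
       (use square_integrable bound in \<open>auto intro!: AE_I2 order_trans[OF bound]\<close>)
qed

lemma integrable_Z: "integrable M (Z i)"
proof -
  have i: "integrable M (\<lambda>\<omega>. 1 + (norm (Z 0 \<omega>))\<^sup>2)" using square_integrable by simp
  have b: "norm z \<le> 1 + (norm z)\<^sup>2" for z :: 'b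
    using sum_squares_bound[of 1 "norm z"] norm_ge_zero[of z] by (simp only: power_one)
  have "integrable M (Z 0)"
    by (rule Bochner_Integration.integrable_bound[OF i]) (auto intro!: AE_I2 order_trans[OF b])
  then show ?thesis using integrable_transfer[of "\<lambda>x. x"] by simp
qed

lemma expectation_Z: "expectation (Z i) = mean"
  using expectation_transfer[of "\<lambda>x. x" i] by (simp add: mean_def)

lemma linear_image:
  fixes l :: "'b \<Rightarrow> 'c::euclidean_space"
  assumes "bounded_linear l"
  shows "iid_square_integrable M (\<lambda>i \<omega>. l (Z i \<omega>))"
proof -
  interpret l: bounded_linear l by fact
  obtain K where K: "K > 0" "\<And>x. norm (l x) \<le> norm x * K" using l.pos_bounded by blast
  show ?thesis
  proof (rule image)
    show "l \<in> borel_measurable borel"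
      by (intro borel_measurable_continuous_onI linear_continuous_on assms)
    show "norm (l z) \<le> K * (1 + norm z)" for z
      using K(2)[of z] K(1) by (simp add: algebra_simps)
  qed
qed

lemma mean_linear_image:
  fixes l :: "'b \<Rightarrow> 'c::euclidean_space"
  assumes l: "bounded_linear l"
  shows "iid_square_integrable.mean M (\<lambda>i \<omega>. l (Z i \<omega>)) = l mean"
  using iid_square_integrable.mean_def[OF linear_image[OF l]] integral_bounded_linear[OF l integrable_Z[of 0]]
  by (simp add: mean_def)

lemma average_linear_image:
  fixes l :: "'b \<Rightarrow> 'c::euclidean_space"
  assumes l: "bounded_linear l"
  shows "iid_square_integrable.average (\<lambda>i \<omega>. l (Z i \<omega>)) n \<omega> = l (average n \<omega>)"
proof -
  interpret l: bounded_linear l by fact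
  show ?thesis
    by (simp add: iid_square_integrable.average_def[OF linear_image[OF l]] average_def l.scaleR l.sum)
qed

end

text \<open>Reduces mean square statements about vectors to their coordinates.\<close>

lemma norm_power2_Basis: "(norm (x::'b::euclidean_space))\<^sup>2 = (\<Sum>b\<in>Basis. (x \<bullet> b)\<^sup>2)"
  by (simp only: power2_norm_eq_inner euclidean_inner[of x x]) (simp add: power2_eq_square)

text \<open>The mixed terms vanish because \<open>Y n\<close> is centred and independent of \<open>\<Sum>j<n. Y j\<close>.\<close>

lemma expectation_square_sum_iid:
  fixes Y :: "nat \<Rightarrow> 'a \<Rightarrow> real"
  assumes iid: "iid_square_integrable M Y" and mean0: "iid_square_integrable.mean M Y = 0"
  shows "integrable M (\<lambda>\<omega>. (\<Sum>j<n. Y j \<omega>)\<^sup>2)"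
    and "(LINT \<omega>|M. (\<Sum>j<n. Y j \<omega>)\<^sup>2) = real n * (LINT \<omega>|M. (Y 0 \<omega>)\<^sup>2)"
proof -
  interpret iid_square_integrable M Y by fact
  have "integrable M (\<lambda>\<omega>. (\<Sum>j<n. Y j \<omega>)\<^sup>2) \<and>
        expectation (\<lambda>\<omega>. (\<Sum>j<n. Y j \<omega>)\<^sup>2) = real n * expectation (\<lambda>\<omega>. (Y 0 \<omega>)\<^sup>2)"
  proof (induction n)
    case (Suc n)
    have ind: "indep_var borel (Y n) borel (\<lambda>\<omega>. \<Sum>j<n. Y j \<omega>)"
      by (rule indep_vars_sum) (auto intro: indep_vars_subset[OF indep])
    have iS: "integrable M (\<lambda>\<omega>. \<Sum>j<n. Y j \<omega>)" using integrable_Z by auto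
    have sq: "integrable M (\<lambda>\<omega>. (Y n \<omega>)\<^sup>2)"
      using integrable_transfer[of "\<lambda>x. x\<^sup>2" n] square_integrable by simp
    have sqe: "expectation (\<lambda>\<omega>. (Y n \<omega>)\<^sup>2) = expectation (\<lambda>\<omega>. (Y 0 \<omega>)\<^sup>2)"
      using expectation_transfer[of "\<lambda>x. x\<^sup>2" n] by simp
    have ip: "integrable M (\<lambda>\<omega>. Y n \<omega> * (\<Sum>j<n. Y j \<omega>))"
      by (rule indep_var_integrable[OF ind integrable_Z iS])
    have ep: "expectation (\<lambda>\<omega>. Y n \<omega> * (\<Sum>j<n. Y j \<omega>)) = 0"
      using indep_var_lebesgue_integral[OF ind integrable_Z iS] expectation_Z mean0 by simp
    have eq: "(\<Sum>j<Suc n. Y j \<omega>)\<^sup>2 = (\<Sum>j<n. Y j \<omega>)\<^sup>2 + 2 * (Y n \<omega> * (\<Sum>j<n. Y j \<omega>)) + (Y n \<omega>)\<^sup>2" for \<omega>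
      by (simp add: power2_sum algebra_simps)
    show ?case unfolding eq
      using Suc ip ep sq sqe by (simp add: algebra_simps)
  qed simp
  then show "integrable M (\<lambda>\<omega>. (\<Sum>j<n. Y j \<omega>)\<^sup>2)"
    and "(LINT \<omega>|M. (\<Sum>j<n. Y j \<omega>)\<^sup>2) = real n * (LINT \<omega>|M. (Y 0 \<omega>)\<^sup>2)" by auto
qed

lemma expectation_square_average_iid:
  fixes Y :: "nat \<Rightarrow> 'a \<Rightarrow> real"
  assumes iid: "iid_square_integrable M Y" and n: "n > 0"
  shows "integrable M (\<lambda>\<omega>. (iid_square_integrable.average Y n \<omega> - iid_square_integrable.mean M Y)\<^sup>2)"
    and "(LINT \<omega>|M. (iid_square_integrable.average Y n \<omega> - iid_square_integrable.mean M Y)\<^sup>2) =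
      (LINT \<omega>|M. (Y 0 \<omega> - iid_square_integrable.mean M Y)\<^sup>2) / real n"
proof -
  interpret iid_square_integrable M Y by fact
  define W where "W i \<omega> = Y i \<omega> - mean" for i \<omega>
  have W: "iid_square_integrable M W" unfolding W_def[abs_def]
  proof (rule image)
    show "norm (z - mean) \<le> (1 + norm mean) * (1 + norm z)" for z
    proof -
      have "norm (z - mean) \<le> norm z + norm mean" by (rule norm_triangle_ineq4)
      also have "\<dots> \<le> (1 + norm mean) * (1 + norm z)" by (simp add: algebra_simps)
      finally show ?thesis .
    qed
  qed simp
  have W0: "iid_square_integrable.mean M W = 0"
    unfolding iid_square_integrable.mean_def[OF W] W_def
    using integrable_Z[of 0] expectation_Z[of 0] prob_space by simp
  have eq: "(average n \<omega> - mean)\<^sup>2 = (\<Sum>j<n. W j \<omega>)\<^sup>2 / (real n)\<^sup>2" for \<omega>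
  proof -
    have "average n \<omega> - mean = (\<Sum>j<n. W j \<omega>) / real n"
      using n by (simp add: average_def W_def sum_subtractf field_simps)
    then show ?thesis by (simp add: power_divide)
  qed
  show "integrable M (\<lambda>\<omega>. (average n \<omega> - mean)\<^sup>2)"
    unfolding eq using expectation_square_sum_iid(1)[OF W W0] by simp
  show "(LINT \<omega>|M. (average n \<omega> - mean)\<^sup>2) = (LINT \<omega>|M. (Y 0 \<omega> - mean)\<^sup>2) / real n"
    unfolding eq using expectation_square_sum_iid(2)[OF W W0] n by (simp add: W_def power2_eq_square)
qed


section \<open>The strong law of large numbers and the mean square error\<close>

text \<open>
  Between consecutive squares a monotone \<open>S\<close> is squeezed by its values at the two squares, and the
  ratio of consecutive squares tends to one.
\<close>

lemma average_tendsto_of_squares: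
  fixes S :: "nat \<Rightarrow> real"
  assumes mono: "mono S" and nonneg: "\<And>n. S n \<ge> 0"
    and lim: "(\<lambda>k. S (k\<^sup>2) / (real k)\<^sup>2) \<longlonglongrightarrow> m"
  shows "(\<lambda>n. S n / real n) \<longlonglongrightarrow> m"
proof -
  define k where "k n = floor_sqrt n" for n
  have k1: "(k n)\<^sup>2 \<le> n" for n unfolding k_def by (rule floor_sqrt_power2_le)
  have k2: "n \<le> (Suc (k n))\<^sup>2" for n unfolding k_def using Suc_floor_sqrt_power2_gt[of n] by simp
  have k_top: "filterlim k at_top sequentially"
    unfolding filterlim_at_top
  proof
    fix N show "\<forall>\<^sub>F n in sequentially. N \<le> k n"
      using eventually_ge_at_top[of "N\<^sup>2"]
      by eventually_elim (use mono_floor_sqrt' in \<open>force simp: k_def\<close>)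
  qed
  \<comment> \<open>\<open>L (k n)\<close> and \<open>U (k n)\<close> are the two sides of
    \<open>S (k\<^sup>2) / (k + 1)\<^sup>2 \<le> S n / n \<le> S ((k + 1)\<^sup>2) / k\<^sup>2\<close>.\<close>
  define L where "L j = S (j\<^sup>2) / (real j)\<^sup>2 * (real j / real (Suc j))\<^sup>2" for j
  define U where "U j = S ((Suc j)\<^sup>2) / (real (Suc j))\<^sup>2 * (real (Suc j) / real j)\<^sup>2" for j
  have "(\<lambda>j. (real j / real (Suc j))\<^sup>2) \<longlonglongrightarrow> 1" "(\<lambda>j. (real (Suc j) / real j)\<^sup>2) \<longlonglongrightarrow> 1"
    by real_asymp+
  from tendsto_mult[OF lim this(1)] tendsto_mult[OF LIMSEQ_Suc[OF lim] this(2)]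
  have LU: "L \<longlonglongrightarrow> m" "U \<longlonglongrightarrow> m" unfolding L_def U_def by simp_all
  have lims: "(\<lambda>n. L (k n)) \<longlonglongrightarrow> m" "(\<lambda>n. U (k n)) \<longlonglongrightarrow> m"
    by (rule filterlim_compose[OF LU(1) k_top], rule filterlim_compose[OF LU(2) k_top])
  have ev: "\<forall>\<^sub>F n in sequentially. L (k n) \<le> S n / real n \<and> S n / real n \<le> U (k n)"
  proof -
    have "\<forall>\<^sub>F n in sequentially. k n \<ge> 1" using k_top unfolding filterlim_at_top by blast
    then show ?thesis
    proof eventually_elim
      case (elim n)
      have n: "(real (k n))\<^sup>2 \<le> real n" "real n \<le> (real (Suc (k n)))\<^sup>2"
        using k1[of n] k2[of n] by (metis of_nat_le_iff of_nat_power)+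
      have n0: "real n > 0" using k1[of n] elim by (cases n) auto
      have "L (k n) = S ((k n)\<^sup>2) / (real (Suc (k n)))\<^sup>2"
        using elim by (simp add: L_def power_divide)
      also have "\<dots> \<le> S n / real n"
        using monoD[OF mono k1[of n]] nonneg n n0 by (intro frac_le) auto
      finally have 1: "L (k n) \<le> S n / real n" .
      have "S n / real n \<le> S ((Suc (k n))\<^sup>2) / (real (k n))\<^sup>2"
        using monoD[OF mono k2[of n]] nonneg n n0 elim by (intro frac_le) auto
      also have "\<dots> = U (k n)" unfolding U_def power_divide by (simp del: of_nat_Suc)
      finally show ?case using 1 by simp
    qed
  qed
  show ?thesis
    by (rule tendsto_sandwich[OF _ _ lims]; rule eventually_mono[OF ev]) auto
qed

text \<open>
  The mean square errors at the sample sizes \<open>(k + 1)\<^sup>2\<close> are summable, so almost surely the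
  averages converge along the squares; monotonicity of the partial sums fills the gaps.
\<close>

lemma strong_law_nonneg:
  fixes Y :: "nat \<Rightarrow> 'a \<Rightarrow> real"
  assumes iid: "iid_square_integrable M Y" and nonneg: "\<And>i \<omega>. Y i \<omega> \<ge> 0"
  shows "AE \<omega> in M. (\<lambda>n. iid_square_integrable.average Y n \<omega>) \<longlonglongrightarrow> iid_square_integrable.mean M Y"
proof -
  interpret iid_square_integrable M Y by fact
  define v where "v = (LINT \<omega>|M. (Y 0 \<omega> - mean)\<^sup>2)"
  define d where "d k \<omega> = (average ((Suc k)\<^sup>2) \<omega> - mean)\<^sup>2" for k \<omega>
  have v: "v \<ge> 0" unfolding v_def by simp
  have d: "integrable M (d k)" "(LINT \<omega>|M. d k \<omega>) = v / (real (Suc k))\<^sup>2" for k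
    unfolding d_def v_def using expectation_square_average_iid[OF iid, of "(Suc k)\<^sup>2"] by simp_all
  have [measurable]: "d k \<in> borel_measurable M" for k unfolding d_def by measurable
  have summ: "summable (\<lambda>k. v / (real (Suc k))\<^sup>2)"
    using summable_mult[OF inverse_power_summable[of 2, where 'a=real], of v] summable_Suc_iff[of "\<lambda>k. v * inverse (real k ^ 2)"]
    by (simp add: divide_inverse)
  have "(\<integral>\<^sup>+\<omega>. (\<Sum>k. ennreal (d k \<omega>)) \<partial>M) = (\<Sum>k. \<integral>\<^sup>+\<omega>. ennreal (d k \<omega>) \<partial>M)"
    by (rule nn_integral_suminf) measurable
  also have "\<dots> = (\<Sum>k. ennreal (v / (real (Suc k))\<^sup>2))"
  proof -
    have "(\<integral>\<^sup>+\<omega>. ennreal (d k \<omega>) \<partial>M) = ennreal (v / (real (Suc k))\<^sup>2)" for k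
      unfolding d(2)[symmetric] by (rule nn_integral_eq_integral[OF d(1)]) (simp add: d_def)
    then show ?thesis by simp
  qed
  also have "\<dots> = ennreal (\<Sum>k. v / (real (Suc k))\<^sup>2)"
    by (rule suminf_ennreal2[OF _ summ]) (use v in simp)
  finally have "AE \<omega> in M. (\<Sum>k. ennreal (d k \<omega>)) \<noteq> \<infinity>"
    by (intro nn_integral_PInf_AE) auto
  then show ?thesis
  proof eventually_elim
    case (elim \<omega>)
    have "summable (\<lambda>k. d k \<omega>)" using elim
      by (intro summable_suminf_not_top) (auto simp: d_def)
    then have "(\<lambda>k. d k \<omega>) \<longlonglongrightarrow> 0" by (rule summable_LIMSEQ_zero)
    from tendsto_real_sqrt[OF this] have "(\<lambda>k. average ((Suc k)\<^sup>2) \<omega> - mean) \<longlonglongrightarrow> 0"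
      unfolding d_def real_sqrt_abs real_sqrt_zero by (rule tendsto_rabs_zero_cancel)
    then have "(\<lambda>k. average ((Suc k)\<^sup>2) \<omega>) \<longlonglongrightarrow> mean" by (rule LIM_zero_cancel)
    then have "(\<lambda>k. average (k\<^sup>2) \<omega>) \<longlonglongrightarrow> mean" by (rule LIMSEQ_imp_Suc)
    then have "(\<lambda>k. (\<Sum>j<k\<^sup>2. Y j \<omega>) / (real k)\<^sup>2) \<longlonglongrightarrow> mean"
      by (simp add: average_def divide_inverse mult.commute)
    then have "(\<lambda>n. (\<Sum>j<n. Y j \<omega>) / real n) \<longlonglongrightarrow> mean"
      by (intro average_tendsto_of_squares monoI sum_mono2 sum_nonneg) (use nonneg in auto)
    then show ?case by (simp add: average_def divide_inverse mult.commute)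
  qed
qed

lemma strong_law_real:
  fixes Y :: "nat \<Rightarrow> 'a \<Rightarrow> real"
  assumes iid: "iid_square_integrable M Y"
  shows "AE \<omega> in M. (\<lambda>n. iid_square_integrable.average Y n \<omega>) \<longlonglongrightarrow> iid_square_integrable.mean M Y"
proof -
  interpret iid_square_integrable M Y by fact
  define P N where "P i \<omega> = max 0 (Y i \<omega>)" and "N i \<omega> = max 0 (- Y i \<omega>)" for i \<omega>
  have P: "iid_square_integrable M P" unfolding P_def[abs_def]
    by (rule image[of _ 1]) auto
  have N: "iid_square_integrable M N" unfolding N_def[abs_def]
    by (rule image[of _ 1]) auto
  interpret P: iid_square_integrable M P by fact
  interpret N: iid_square_integrable M N by fact
  have Y: "Y i \<omega> = P i \<omega> - N i \<omega>" for i \<omega> by (simp add: P_def N_def)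
  have avg: "average n \<omega> = P.average n \<omega> - N.average n \<omega>" for n \<omega>
    by (simp add: average_def P.average_def N.average_def Y sum_subtractf right_diff_distrib)
  have mean: "mean = P.mean - N.mean"
    unfolding mean_def P.mean_def N.mean_def
    by (subst Bochner_Integration.integral_diff[symmetric]) (auto simp: P.integrable_Z N.integrable_Z Y[symmetric])
  have "AE \<omega> in M. (\<lambda>n. P.average n \<omega>) \<longlonglongrightarrow> P.mean" by (rule strong_law_nonneg[OF P]) (simp add: P_def)
  moreover have "AE \<omega> in M. (\<lambda>n. N.average n \<omega>) \<longlonglongrightarrow> N.mean" by (rule strong_law_nonneg[OF N]) (simp add: N_def)
  ultimately show ?thesis
    by eventually_elim (unfold avg mean, rule tendsto_diff)
qed

context iid_square_integrable
begin

theorem strong_law: "AE \<omega> in M. (\<lambda>n. average n \<omega>) \<longlonglongrightarrow> mean"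
proof -
  have "AE \<omega> in M. (\<lambda>n. average n \<omega> \<bullet> b) \<longlonglongrightarrow> mean \<bullet> b" for b
    using strong_law_real[OF linear_image[OF bounded_linear_inner_left[of b]]]
    by (simp add: mean_linear_image[OF bounded_linear_inner_left] average_linear_image[OF bounded_linear_inner_left])
  then have "AE \<omega> in M. \<forall>b\<in>Basis. (\<lambda>n. average n \<omega> \<bullet> b) \<longlonglongrightarrow> mean \<bullet> b"
    by (intro AE_finite_allI) auto
  then show ?thesis by eventually_elim (simp add: tendsto_componentwise_iff[of _ mean])
qed

theorem mean_square_error:
  assumes n: "n > 0"
  shows "integrable M (\<lambda>\<omega>. (norm (average n \<omega> - mean))\<^sup>2)"
    and "expectation (\<lambda>\<omega>. (norm (average n \<omega> - mean))\<^sup>2) = dispersion / real n"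
proof -
  note l = bounded_linear_inner_left
  have c: "integrable M (\<lambda>\<omega>. ((average n \<omega> - mean) \<bullet> b)\<^sup>2)"
    "expectation (\<lambda>\<omega>. ((average n \<omega> - mean) \<bullet> b)\<^sup>2) = expectation (\<lambda>\<omega>. ((Z 0 \<omega> - mean) \<bullet> b)\<^sup>2) / real n" for b
    using expectation_square_average_iid[OF linear_image[OF l[of b]] n]
    by (simp_all add: mean_linear_image[OF l] average_linear_image[OF l] inner_diff_left)
  have c1: "integrable M (\<lambda>\<omega>. ((Z 0 \<omega> - mean) \<bullet> b)\<^sup>2)" for b
  proof -
    have "iid_square_integrable.average Z 1 = Z 0" by (auto simp: average_def)
    then show ?thesis
      using expectation_square_average_iid(1)[OF linear_image[OF l[of b]], of 1]
      by (simp add: mean_linear_image[OF l] average_linear_image[OF l] inner_diff_left)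
  qed
  show "integrable M (\<lambda>\<omega>. (norm (average n \<omega> - mean))\<^sup>2)"
    unfolding norm_power2_Basis using c by auto
  show "expectation (\<lambda>\<omega>. (norm (average n \<omega> - mean))\<^sup>2) = dispersion / real n"
    unfolding norm_power2_Basis dispersion_def using c c1 by (simp add: sum_divide_distrib)
qed

lemma dispersion_nonneg: "dispersion \<ge> 0" unfolding dispersion_def by simp

end


section \<open>Consistency of smooth functions of the average\<close>

context iid_square_integrable
begin

lemma scaled_square_error:
  "integrable M (\<lambda>\<omega>. (norm (sqrt (real n) *\<^sub>R (average n \<omega> - mean)))\<^sup>2)"
  "expectation (\<lambda>\<omega>. (norm (sqrt (real n) *\<^sub>R (average n \<omega> - mean)))\<^sup>2) \<le> dispersion"
proof -
  have eq: "(norm (sqrt (real n) *\<^sub>R (average n \<omega> - mean)))\<^sup>2 = real n * (norm (average n \<omega> - mean))\<^sup>2" for \<omega>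
    by (simp add: power_mult_distrib)
  show "integrable M (\<lambda>\<omega>. (norm (sqrt (real n) *\<^sub>R (average n \<omega> - mean)))\<^sup>2)"
    unfolding eq using mean_square_error(1) by (cases "n = 0") auto
  show "expectation (\<lambda>\<omega>. (norm (sqrt (real n) *\<^sub>R (average n \<omega> - mean)))\<^sup>2) \<le> dispersion"
    unfolding eq using mean_square_error(2) dispersion_nonneg by (cases "n = 0") auto
qed

theorem strongly_consistent_continuous:
  fixes g :: "'b \<Rightarrow> 'c::{real_normed_vector, second_countable_topology}"
  assumes [measurable]: "g \<in> borel_measurable borel" and "isCont g mean"
  shows "strongly_consistent M (\<lambda>n \<omega>. g (average n \<omega>)) (g mean)"
  unfolding strongly_consistent_def
proof (intro conjI allI)
  show "AE \<omega> in M. (\<lambda>n. g (average n \<omega>)) \<longlonglongrightarrow> g mean"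
    using strong_law by eventually_elim (rule isCont_tendsto_compose[OF assms(2)])
qed measurable

text \<open>
  Near the mean, \<open>g\<close> is controlled by the Lipschitz bound; the event of being far from the mean has
  probability \<open>O(1/n)\<close>. Both are read off from the second moment as in Chebyshev's inequality.
  The finitely many sample sizes for which the second bound is not yet small are handled by
  the tightness of single random variables.
\<close>

theorem sqrt_n_consistent_lipschitz:
  fixes g :: "'b \<Rightarrow> 'c::{real_normed_vector, second_countable_topology}"
  assumes g[measurable]: "g \<in> borel_measurable borel"
    and \<delta>: "\<delta> > 0" and lip: "\<And>x. norm (x - mean) < \<delta> \<Longrightarrow> norm (g x - g mean) \<le> L * norm (x - mean)"
  shows "sqrt_n_consistent M (\<lambda>n \<omega>. g (average n \<omega>)) (g mean)"
  unfolding sqrt_n_consistent_def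
proof (intro conjI allI impI)
  fix e :: real assume e: "e > 0"
  define G where "G n \<omega> = norm (sqrt (real n) *\<^sub>R (g (average n \<omega>) - g mean))" for n \<omega>
  have [measurable]: "G n \<in> borel_measurable M" for n unfolding G_def by measurable
  define T where "T n \<omega> = (norm (sqrt (real n) *\<^sub>R (average n \<omega> - mean)))\<^sup>2" for n \<omega>
  have T: "integrable M (T n)" "expectation (T n) \<le> dispersion" "T n \<omega> \<ge> 0" for n \<omega>
    unfolding T_def using scaled_square_error by auto
  \<comment> \<open>\<open>n0\<close> and \<open>K0\<close> are chosen such that each of the two bounds is at most \<open>e / 2\<close>.\<close>
  obtain n0 :: nat where n0: "2 * dispersion / (\<delta>\<^sup>2 * e) < real n0" using reals_Archimedean2 by blast
  define n1 where "n1 = Suc n0"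
  define K0 where "K0 = sqrt (2 * L\<^sup>2 * dispersion / e) + 1"
  have K0: "K0 > 0" "2 * L\<^sup>2 * dispersion \<le> e * K0\<^sup>2"
  proof -
    have s: "sqrt (2 * L\<^sup>2 * dispersion / e) \<ge> 0" using dispersion_nonneg e by auto
    then show "K0 > 0" unfolding K0_def by linarith
    have "2 * L\<^sup>2 * dispersion / e = (sqrt (2 * L\<^sup>2 * dispersion / e))\<^sup>2" using dispersion_nonneg e by simp
    also have "\<dots> \<le> K0\<^sup>2" unfolding K0_def using s by (intro power_mono) auto
    finally show "2 * L\<^sup>2 * dispersion \<le> e * K0\<^sup>2" using e by (simp add: field_simps)
  qed
  have large: "measure M {\<omega> \<in> space M. G n \<omega> > K0} \<le> e" if n: "n \<ge> n1" for n
  proof -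
    have np: "real n > 0" using n by (simp add: n1_def)
    have bound: "indicator {\<omega> \<in> space M. G n \<omega> > K0} \<omega> \<le> (L\<^sup>2 / K0\<^sup>2 + 1 / (\<delta>\<^sup>2 * real n)) * T n \<omega>" for \<omega>
    proof (cases "G n \<omega> > K0")
      case True
      show ?thesis
      proof (cases "norm (average n \<omega> - mean) < \<delta>")
        case near: True
        have "K0 \<le> sqrt (real n) * norm (g (average n \<omega>) - g mean)" using True by (simp add: G_def)
        also have "\<dots> \<le> sqrt (real n) * (L * norm (average n \<omega> - mean))"
          using lip[OF near] by (intro mult_left_mono) auto
        finally have "K0\<^sup>2 \<le> (sqrt (real n) * (L * norm (average n \<omega> - mean)))\<^sup>2" 
          using K0 by (intro power_mono) auto
        also have "\<dots> = L\<^sup>2 * T n \<omega>" by (simp add: T_def power_mult_distrib)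
        finally have "1 \<le> L\<^sup>2 / K0\<^sup>2 * T n \<omega>" using K0 by (simp add: field_simps)
        moreover have "0 \<le> 1 / (\<delta>\<^sup>2 * real n) * T n \<omega>" using T(3) by simp
        ultimately show ?thesis by (simp add: distrib_right indicator_def)
      next
        case False
        then have "\<delta>\<^sup>2 \<le> (norm (average n \<omega> - mean))\<^sup>2" using \<delta> by (intro power_mono) auto
        then have "1 \<le> 1 / (\<delta>\<^sup>2 * real n) * T n \<omega>"
          using \<delta> np by (simp add: T_def power_mult_distrib)
        moreover have "0 \<le> L\<^sup>2 / K0\<^sup>2 * T n \<omega>" using T(3) by simp
        ultimately show ?thesis by (simp add: distrib_right indicator_def)
      qed
    qed (use T(3) in simp)
    have "measure M {\<omega> \<in> space M. G n \<omega> > K0} = expectation (indicator {\<omega> \<in> space M. G n \<omega> > K0})"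
      by simp
    also have "\<dots> \<le> expectation (\<lambda>\<omega>. (L\<^sup>2 / K0\<^sup>2 + 1 / (\<delta>\<^sup>2 * real n)) * T n \<omega>)"
      using bound by (intro integral_mono integrable_mult_right T(1) integrable_const_bound[of _ 1]) auto
    also have "\<dots> \<le> (L\<^sup>2 / K0\<^sup>2 + 1 / (\<delta>\<^sup>2 * real n)) * dispersion"
      using T(2) by (simp add: mult_left_mono)
    also have "\<dots> = L\<^sup>2 * dispersion / K0\<^sup>2 + dispersion / (\<delta>\<^sup>2 * real n)" by (simp add: distrib_right)
    also have "\<dots> \<le> e / 2 + e / 2"
    proof (rule add_mono)
      show "L\<^sup>2 * dispersion / K0\<^sup>2 \<le> e / 2" using K0 by (simp add: field_simps)
      have "2 * dispersion / (\<delta>\<^sup>2 * e) \<le> real n" using n0 n by (simp add: n1_def)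
      then show "dispersion / (\<delta>\<^sup>2 * real n) \<le> e / 2" using np \<delta> e by (simp add: field_simps)
    qed
    finally show ?thesis by simp
  qed
  have "\<exists>K. measure M {\<omega> \<in> space M. G n \<omega> > K} \<le> e" for n
    using tight_single[of "G n", OF _ e] by (simp add: G_def)
  then obtain k where k: "\<And>n. measure M {\<omega> \<in> space M. G n \<omega> > k n} \<le> e" by metis
  define K where "K = Max (insert K0 (k ` {..<n1}))"
  have "measure M {\<omega> \<in> space M. G n \<omega> > K} \<le> e" for n
  proof -
    have *: ?thesis if "K' \<le> K" "measure M {\<omega> \<in> space M. G n \<omega> > K'} \<le> e" for K'
    proof -
      have "measure M {\<omega> \<in> space M. G n \<omega> > K} \<le> measure M {\<omega> \<in> space M. G n \<omega> > K'}"
        using that(1) by (intro finite_measure_mono) auto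
      then show ?thesis using that(2) by simp
    qed
    show ?thesis
    proof (cases "n \<ge> n1")
      case True
      then show ?thesis using *[OF _ large] by (simp add: K_def)
    next
      case False
      then show ?thesis using *[OF _ k[of n]] by (simp add: K_def)
    qed
  qed
  then show "\<exists>K. \<forall>n. measure M {\<omega> \<in> space M. norm (sqrt (real n) *\<^sub>R (g (average n \<omega>) - g mean)) > K} \<le> e"
    unfolding G_def by blast
qed measurable

corollary sqrt_n_consistent_differentiable:
  fixes g :: "'b \<Rightarrow> 'c::{real_normed_vector, second_countable_topology}"
  assumes g: "g \<in> borel_measurable borel" and "g differentiable (at mean)"
  shows "sqrt_n_consistent M (\<lambda>n \<omega>. g (average n \<omega>)) (g mean)"
proof -
  obtain D where D: "(g has_derivative D) (at mean)" using assms(2) by (auto simp: differentiable_def)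
  interpret D: bounded_linear D using D by (rule has_derivative_bounded_linear)
  obtain K where K: "\<And>x. norm (D x) \<le> norm x * K" using D.bounded by blast
  obtain \<delta> where \<delta>: "\<delta> > 0" "\<And>x. norm (x - mean) < \<delta> \<Longrightarrow> norm (g x - g mean - D (x - mean)) \<le> 1 * norm (x - mean)"
    using D unfolding has_derivative_at_alt by (metis zero_less_one)
  show ?thesis
  proof (rule sqrt_n_consistent_lipschitz[OF g \<delta>(1)])
    fix x assume x: "norm (x - mean) < \<delta>"
    have "norm (g x - g mean) \<le> norm (g x - g mean - D (x - mean)) + norm (D (x - mean))"
      using norm_triangle_ineq[of "g x - g mean - D (x - mean)" "D (x - mean)"] by simp
    then show "norm (g x - g mean) \<le> (1 + K) * norm (x - mean)"
      using \<delta>(2)[OF x] K[of "x - mean"] by (simp add: algebra_simps)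
  qed
qed

end


section \<open>The delta method\<close>

text \<open>
  For positive variance this is the central limit theorem, evaluated at the standard deviation.
  For variance zero, the partial sums vanish almost surely.
\<close>

lemma char_clt_iid:
  fixes Y :: "nat \<Rightarrow> 'a \<Rightarrow> real"
  assumes iid: "iid_square_integrable M Y" and mean0: "iid_square_integrable.mean M Y = 0"
  shows "(\<lambda>n. LINT \<omega>|M. iexp ((\<Sum>j<n. Y j \<omega>) / sqrt (real n)))
    \<longlonglongrightarrow> complex_of_real (exp (- (LINT \<omega>|M. (Y 0 \<omega>)\<^sup>2) / 2))"
proof -
  interpret iid_square_integrable M Y by fact
  define v where "v = (LINT \<omega>|M. (Y 0 \<omega>)\<^sup>2)"
  have v0: "v \<ge> 0" unfolding v_def by simp
  show ?thesis
  proof (cases "v = 0")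
    case True
    have "(LINT \<omega>|M. iexp ((\<Sum>j<n. Y j \<omega>) / sqrt (real n))) = 1" for n
    proof -
      have "(LINT \<omega>|M. (\<Sum>j<n. Y j \<omega>)\<^sup>2) = 0"
        using expectation_square_sum_iid(2)[OF iid mean0, of n] True by (simp add: v_def)
      then have "AE \<omega> in M. (\<Sum>j<n. Y j \<omega>) = 0"
        using integral_nonneg_eq_0_iff_AE[OF expectation_square_sum_iid(1)[OF iid mean0, of n]] by simp
      then have "AE \<omega> in M. iexp ((\<Sum>j<n. Y j \<omega>) / sqrt (real n)) = 1"
        by eventually_elim (simp only: div_0 of_real_0 mult_zero_right exp_zero)
      then have "(LINT \<omega>|M. iexp ((\<Sum>j<n. Y j \<omega>) / sqrt (real n))) = (LINT \<omega>|M. 1)"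
        by (rule integral_cong_AE[rotated 2]) measurable
      then show ?thesis using prob_space by simp
    qed
    then show ?thesis using True by (simp add: v_def[symmetric])
  next
    case False
    define \<sigma> where "\<sigma> = sqrt v"
    have s: "\<sigma> > 0" "\<sigma>\<^sup>2 = v" using False v0 by (auto simp: \<sigma>_def)
    have sqi: "integrable M (\<lambda>\<omega>. (Y n \<omega>)\<^sup>2)" for n
      using integrable_transfer[of "\<lambda>x. x\<^sup>2" n] square_integrable by simp
    have var: "expectation (\<lambda>\<omega>. (Y n \<omega>)\<^sup>2) = \<sigma>\<^sup>2" for n
      using expectation_transfer[of "\<lambda>x. x\<^sup>2" n] s by (simp add: v_def)
    have "weak_conv_m (\<lambda>n. distr M borel (\<lambda>\<omega>. (\<Sum>i<n. Y i \<omega> - 0) / sqrt (n * \<sigma>\<^sup>2))) std_normal_distribution"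
      by (rule central_limit_theorem[OF indep, where m = 0 and \<mu> = "distr M borel (Y 0)"])
         (use s sqi var ident expectation_Z mean0 in auto)
    then have "(\<lambda>n. char (distr M borel (\<lambda>\<omega>. (\<Sum>i<n. Y i \<omega> - 0) / sqrt (n * \<sigma>\<^sup>2))) \<sigma>) \<longlonglongrightarrow> char std_normal_distribution \<sigma>"
      by (intro levy_continuity1 real_distribution_distr real_dist_normal_dist) auto
    moreover have "char (distr M borel (\<lambda>\<omega>. (\<Sum>i<n. Y i \<omega> - 0) / sqrt (n * \<sigma>\<^sup>2))) \<sigma>
       = (LINT \<omega>|M. iexp ((\<Sum>j<n. Y j \<omega>) / sqrt (real n)))" for n
      unfolding char_def using s(1) by (subst integral_distr) (auto simp: real_sqrt_mult)
    ultimately show ?thesis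
      by (simp add: char_std_normal_distribution s(2) v_def)
  qed
qed

context iid_square_integrable
begin

text \<open>The covariance matrix of \<open>D (Z 0)\<close> when \<open>D\<close> is linear.\<close>

definition covariance_image :: "('b \<Rightarrow> real ^ 'k) \<Rightarrow> real ^ 'k ^ 'k" where
  "covariance_image D = (\<chi> k l. expectation (\<lambda>\<omega>. D (Z 0 \<omega> - mean) $ k * D (Z 0 \<omega> - mean) $ l))"

lemma covariance_image_quadratic:
  fixes D :: "'b \<Rightarrow> real ^ 'k"
  assumes D: "bounded_linear D"
  shows "integrable M (\<lambda>\<omega>. (u \<bullet> D (Z 0 \<omega> - mean))\<^sup>2)"
    and "u \<bullet> (covariance_image D *v u) = expectation (\<lambda>\<omega>. (u \<bullet> D (Z 0 \<omega> - mean))\<^sup>2)"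
proof -
  have sq: "integrable M (\<lambda>\<omega>. (norm (Z 0 \<omega> - mean))\<^sup>2)"
    using mean_square_error(1)[of 1] by (simp add: average_def)
  obtain K where K: "\<And>x. norm (D x) \<le> norm x * K" "K \<ge> 0" using bounded_linear.nonneg_bounded[OF D] by blast
  have [measurable]: "D \<in> borel_measurable borel"
    by (intro borel_measurable_continuous_onI linear_continuous_on D)
  have [measurable]: "(\<lambda>\<omega>. D (Z 0 \<omega> - mean) $ k) \<in> borel_measurable M" for k
    by (rule measurable_compose[where g = "\<lambda>x. x $ k" and N = borel])
       (auto intro!: borel_measurable_continuous_onI continuous_intros)
  have DK: "(norm (D x))\<^sup>2 \<le> K\<^sup>2 * (norm x)\<^sup>2" for x
    using power_mono[OF K(1)[of x], of 2] by (simp add: power_mult_distrib mult.commute)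
  have int: "integrable M (\<lambda>\<omega>. D (Z 0 \<omega> - mean) $ k * D (Z 0 \<omega> - mean) $ l)" for k l
  proof (rule Bochner_Integration.integrable_bound[OF integrable_mult_right[OF sq, of "K\<^sup>2"]])
    show "AE \<omega> in M. norm (D (Z 0 \<omega> - mean) $ k * D (Z 0 \<omega> - mean) $ l) \<le> norm (K\<^sup>2 * (norm (Z 0 \<omega> - mean))\<^sup>2)"
    proof (rule AE_I2)
      fix \<omega>
      have "norm (D (Z 0 \<omega> - mean) $ k * D (Z 0 \<omega> - mean) $ l) \<le> norm (D (Z 0 \<omega> - mean)) * norm (D (Z 0 \<omega> - mean))"
        unfolding real_norm_def abs_mult by (intro mult_mono component_le_norm_cart) auto
      then show "norm (D (Z 0 \<omega> - mean) $ k * D (Z 0 \<omega> - mean) $ l) \<le> norm (K\<^sup>2 * (norm (Z 0 \<omega> - mean))\<^sup>2)"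
        using DK[of "Z 0 \<omega> - mean"] by (simp add: power2_eq_square)
    qed
  qed measurable
  have eq: "(u \<bullet> w)\<^sup>2 = (\<Sum>k\<in>UNIV. \<Sum>l\<in>UNIV. u $ k * u $ l * (w $ k * w $ l))" for w
    unfolding inner_vec_def inner_real_def power2_eq_square sum_product by (simp add: mult_ac)
  show "integrable M (\<lambda>\<omega>. (u \<bullet> D (Z 0 \<omega> - mean))\<^sup>2)"
    unfolding eq using int by auto
  show "u \<bullet> (covariance_image D *v u) = expectation (\<lambda>\<omega>. (u \<bullet> D (Z 0 \<omega> - mean))\<^sup>2)"
    unfolding eq using int
    by (simp add: covariance_image_def inner_vec_def matrix_vector_mult_def sum_distrib_left mult_ac)
qed

lemma covariance_image_nonneg_definite:
  assumes D: "bounded_linear D"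
  shows "nonneg_definite (covariance_image D)"
  unfolding nonneg_definite_def covariance_image_quadratic(2)[OF D]
  by (auto simp: covariance_image_def transpose_def vec_eq_iff mult.commute)

lemma char_linear_average:
  fixes l :: "'b \<Rightarrow> real"
  assumes l: "bounded_linear l"
  shows "(\<lambda>n. LINT \<omega>|M. iexp (l (sqrt (real n) *\<^sub>R (average n \<omega> - mean))))
    \<longlonglongrightarrow> complex_of_real (exp (- (LINT \<omega>|M. (l (Z 0 \<omega> - mean))\<^sup>2) / 2))"
proof -
  interpret l: bounded_linear l by fact
  obtain K where K: "\<And>x. norm (l x) \<le> norm x * K" "K > 0" using l.pos_bounded by blast
  define Y where "Y i \<omega> = l (Z i \<omega> - mean)" for i \<omega>
  have Y: "iid_square_integrable M Y" unfolding Y_def[abs_def]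
  proof (rule image)
    have [measurable]: "l \<in> borel_measurable borel"
      by (intro borel_measurable_continuous_onI linear_continuous_on l)
    show "(\<lambda>z. l (z - mean)) \<in> borel_measurable borel" by measurable
    show "norm (l (z - mean)) \<le> (K * (1 + norm mean)) * (1 + norm z)" for z
    proof -
      have "norm (l (z - mean)) \<le> K * norm (z - mean)" using K(1) by (simp add: mult.commute)
      also have "norm (z - mean) \<le> (1 + norm mean) * (1 + norm z)"
        by (rule order_trans[OF norm_triangle_ineq4]) (simp add: algebra_simps)
      finally show ?thesis using K(2) by (simp add: mult.assoc)
    qed
  qed
  have "iid_square_integrable.mean M Y = 0"
    unfolding iid_square_integrable.mean_def[OF Y] Y_def
    using integral_bounded_linear[OF l, of M "\<lambda>\<omega>. Z 0 \<omega> - mean"] integrable_Z[of 0] expectation_Z[of 0] prob_space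
    by (simp add: l.zero)
  from char_clt_iid[OF Y this]
  have "(\<lambda>n. LINT \<omega>|M. iexp ((\<Sum>j<n. Y j \<omega>) / sqrt (real n))) \<longlonglongrightarrow> complex_of_real (exp (- (LINT \<omega>|M. (Y 0 \<omega>)\<^sup>2) / 2))" .
  moreover have "(\<Sum>j<n. Y j \<omega>) / sqrt (real n) = l (sqrt (real n) *\<^sub>R (average n \<omega> - mean))" for n \<omega>
  proof (cases "n = 0")
    case False
    have "(\<Sum>j<n. Y j \<omega>) = l ((\<Sum>j<n. Z j \<omega>) - real n *\<^sub>R mean)"
      by (simp add: Y_def l.sum[symmetric] sum_subtractf sum_constant_scaleR)
    also have "(\<Sum>j<n. Z j \<omega>) - real n *\<^sub>R mean = real n *\<^sub>R (average n \<omega> - mean)"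
      using False by (simp add: average_def scaleR_diff_right)
    also have "l (real n *\<^sub>R (average n \<omega> - mean)) / sqrt (real n) = l (sqrt (real n) *\<^sub>R (average n \<omega> - mean))"
      by (simp only: l.scaleR real_scaleR_def times_divide_eq_left[symmetric] real_div_sqrt of_nat_0_le_iff)
    finally show ?thesis .
  qed (simp add: l.zero)
  ultimately show ?thesis by (simp only: Y_def)
qed

text \<open>
  Both hypotheses of the continuity theorem are at hand: tightness is \<open>\<surd>n\<close>-consistency, and the
  characteristic functions of the scaled error and of its linearization \<open>D (V n)\<close> differ by a term
  that tends to zero, because the error of linearization is at most \<open>\<eta>\<close> times the norm of \<open>V n\<close>
  near the mean. For the linearization, each direction \<open>u\<close> is a one-dimensional problem.
\<close>

theorem delta_method:
  fixes g :: "'b \<Rightarrow> real ^ 2"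
  assumes g[measurable]: "g \<in> borel_measurable borel" and D: "(g has_derivative D) (at mean)"
  shows "\<exists>\<Sigma> N. nonneg_definite \<Sigma> \<and> normal_distribution 0 \<Sigma> N \<and>
    weakly_converges (\<lambda>n. distr M borel (\<lambda>\<omega>. sqrt (real n) *\<^sub>R (g (average n \<omega>) - g mean))) N"
proof -
  have bl: "bounded_linear D" using D by (rule has_derivative_bounded_linear)
  then interpret D: bounded_linear D .
  have [measurable]: "D \<in> borel_measurable borel"
    by (intro borel_measurable_continuous_onI linear_continuous_on bl)
  define \<Sigma> where "\<Sigma> = covariance_image D"
  have \<Sigma>: "nonneg_definite \<Sigma>" unfolding \<Sigma>_def by (rule covariance_image_nonneg_definite[OF bl])
  obtain N where N: "normal_distribution 0 \<Sigma> N" using bivariate_normal_exists[OF \<Sigma>] by blast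
  have charN: "(LINT x|N. iexp (u \<bullet> x)) = exp (- complex_of_real (u \<bullet> (\<Sigma> *v u)) / 2)" for u
    using N by (simp add: normal_distribution_def)
  define E where "E n \<omega> = sqrt (real n) *\<^sub>R (g (average n \<omega>) - g mean)" for n \<omega>
  define V where "V n \<omega> = sqrt (real n) *\<^sub>R (average n \<omega> - mean)" for n \<omega>
  have [measurable]: "E n \<in> borel_measurable M" "V n \<in> borel_measurable M" for n
    unfolding E_def V_def by measurable
  have "weakly_converges (\<lambda>n. distr M borel (E n)) N"
  proof (rule weakly_converges_char_tight)
    fix e :: real assume e: "e > 0"
    have "sqrt_n_consistent M (\<lambda>n \<omega>. g (average n \<omega>)) (g mean)"
      by (rule sqrt_n_consistent_differentiable[OF g]) (use D in \<open>auto simp: differentiable_def\<close>)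
    then obtain K where "\<And>n. measure M {\<omega> \<in> space M. norm (E n \<omega>) > K} \<le> e"
      using e unfolding sqrt_n_consistent_def E_def by blast
    then have "measure (distr M borel (E n)) {x. norm x > K} \<le> e" for n
      by (subst measure_distr) (auto simp: vimage_def Int_def conj_commute)
    then show "\<exists>K. \<forall>n. measure (distr M borel (E n)) {x. norm x > K} \<le> e" by blast
  next
    fix u :: "real ^ 2"
    have "(\<lambda>n. LINT \<omega>|M. iexp (u \<bullet> D (V n \<omega>))) \<longlonglongrightarrow> complex_of_real (exp (- (LINT \<omega>|M. (u \<bullet> D (Z 0 \<omega> - mean))\<^sup>2) / 2))"
      unfolding V_def using char_linear_average[of "\<lambda>x. u \<bullet> D x"] bounded_linear_compose[OF bounded_linear_inner_right[of u] bl]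
      by (simp add: comp_def)
    then have lim: "(\<lambda>n. LINT \<omega>|M. iexp (u \<bullet> D (V n \<omega>))) \<longlonglongrightarrow> (LINT x|N. iexp (u \<bullet> x))"
      unfolding charN \<Sigma>_def covariance_image_quadratic(2)[OF bl] by (simp add: exp_of_real[symmetric])
    have "(\<lambda>n. (LINT \<omega>|M. iexp (u \<bullet> E n \<omega>)) - (LINT \<omega>|M. iexp (u \<bullet> D (V n \<omega>)))) \<longlonglongrightarrow> 0"
      unfolding LIMSEQ_iff
    proof (intro allI impI)
      fix r :: real assume r: "r > 0"
      define P where "P = (norm u + 1) * (1 + dispersion)"
      have P: "P > 0" unfolding P_def using dispersion_nonneg
        by (intro mult_pos_pos add_nonneg_pos add_pos_nonneg) auto
      define \<eta> where "\<eta> = r / (2 * P)"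
      have \<eta>: "\<eta> > 0" using r P by (simp add: \<eta>_def)
      have \<eta>2: "norm u * \<eta> * (1 + dispersion) \<le> r / 2"
      proof -
        have "norm u * \<eta> * (1 + dispersion) \<le> (norm u + 1) * \<eta> * (1 + dispersion)"
          using \<eta> dispersion_nonneg by (intro mult_right_mono) auto
        also have "\<dots> = P * \<eta>" by (simp add: P_def)
        also have "\<dots> = r / 2" using P by (simp add: \<eta>_def)
        finally show ?thesis .
      qed
      obtain \<delta> where \<delta>: "\<delta> > 0" "\<And>x. norm (x - mean) < \<delta> \<Longrightarrow> norm (g x - g mean - D (x - mean)) \<le> \<eta> * norm (x - mean)"
        using D \<eta> unfolding has_derivative_at_alt by blast
      obtain n0 :: nat where n0: "4 * dispersion / (\<delta>\<^sup>2 * r) < real n0" using reals_Archimedean2 by blast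
      have "norm ((LINT \<omega>|M. iexp (u \<bullet> E n \<omega>)) - (LINT \<omega>|M. iexp (u \<bullet> D (V n \<omega>))) - 0) < r" if n: "n \<ge> Suc n0" for n
      proof -
        have np: "real n > 0" using n by simp
        \<comment> \<open>The two summands bound the cases of an average near to and far from the mean; only
          second moments of \<open>V n\<close> enter.\<close>
        have bound: "norm (iexp (u \<bullet> E n \<omega>) - iexp (u \<bullet> D (V n \<omega>))) \<le>
            norm u * \<eta> * (1 + (norm (V n \<omega>))\<^sup>2) + 2 / (\<delta>\<^sup>2 * real n) * (norm (V n \<omega>))\<^sup>2" for \<omega>
        proof (cases "norm (average n \<omega> - mean) < \<delta>")
          case True
          have "iexp (u \<bullet> E n \<omega>) - iexp (u \<bullet> D (V n \<omega>)) = iexp (u \<bullet> D (V n \<omega>)) * (iexp (u \<bullet> (E n \<omega> - D (V n \<omega>))) - 1)"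
            by (simp add: inner_diff_right right_diff_distrib exp_add[symmetric] algebra_simps)
          then have "norm (iexp (u \<bullet> E n \<omega>) - iexp (u \<bullet> D (V n \<omega>))) = norm (iexp (u \<bullet> (E n \<omega> - D (V n \<omega>))) - 1)"
            by (simp add: norm_mult)
          also have "\<dots> \<le> \<bar>u \<bullet> (E n \<omega> - D (V n \<omega>))\<bar>"
            using iexp_approx1[of "u \<bullet> (E n \<omega> - D (V n \<omega>))" 0] by simp
          also have "\<dots> \<le> norm u * norm (E n \<omega> - D (V n \<omega>))" by (rule Cauchy_Schwarz_ineq2)
          also have "E n \<omega> - D (V n \<omega>) = sqrt (real n) *\<^sub>R (g (average n \<omega>) - g mean - D (average n \<omega> - mean))"
            by (simp only: E_def V_def D.scaleR scaleR_diff_right[symmetric])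
          also have "norm u * norm (sqrt (real n) *\<^sub>R (g (average n \<omega>) - g mean - D (average n \<omega> - mean))) \<le>
              norm u * (sqrt (real n) * (\<eta> * norm (average n \<omega> - mean)))"
            using \<delta>(2)[OF True] by (simp add: mult_left_mono)
          also have "\<dots> = norm u * \<eta> * norm (V n \<omega>)" by (simp add: V_def)
          also have "\<dots> \<le> norm u * \<eta> * (1 + (norm (V n \<omega>))\<^sup>2)"
            proof (rule mult_left_mono)
            show "norm (V n \<omega>) \<le> 1 + (norm (V n \<omega>))\<^sup>2"
              using sum_squares_bound[of 1 "norm (V n \<omega>)"] norm_ge_zero[of "V n \<omega>"] by (simp only: power_one)
          qed (use \<eta> in simp)
          also have "\<dots> \<le> \<dots> + 2 / (\<delta>\<^sup>2 * real n) * (norm (V n \<omega>))\<^sup>2" by simp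
          finally show ?thesis .
        next
          case False
          then have "\<delta>\<^sup>2 \<le> (norm (average n \<omega> - mean))\<^sup>2" using \<delta>(1) by (intro power_mono) auto
          moreover have "(norm (V n \<omega>))\<^sup>2 = real n * (norm (average n \<omega> - mean))\<^sup>2"
            unfolding V_def norm_scaleR power_mult_distrib by simp
          ultimately have "2 \<le> 2 / (\<delta>\<^sup>2 * real n) * (norm (V n \<omega>))\<^sup>2"
            using \<delta>(1) np by (simp add: pos_le_divide_eq)
          moreover have "norm (iexp (u \<bullet> E n \<omega>) - iexp (u \<bullet> D (V n \<omega>))) \<le> 2"
            using norm_triangle_ineq4[of "iexp (u \<bullet> E n \<omega>)" "iexp (u \<bullet> D (V n \<omega>))"] by simp
          moreover have "0 \<le> norm u * \<eta> * (1 + (norm (V n \<omega>))\<^sup>2)" using \<eta> by simp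
          ultimately show ?thesis by linarith
        qed
        have iV: "integrable M (\<lambda>\<omega>. (norm (V n \<omega>))\<^sup>2)" "expectation (\<lambda>\<omega>. (norm (V n \<omega>))\<^sup>2) \<le> dispersion"
          unfolding V_def by (rule scaled_square_error)+
        have i1: "integrable M (\<lambda>\<omega>. iexp (u \<bullet> E n \<omega>))" "integrable M (\<lambda>\<omega>. iexp (u \<bullet> D (V n \<omega>)))"
          by (auto intro!: integrable_const_bound[of _ 1])
        have "norm ((LINT \<omega>|M. iexp (u \<bullet> E n \<omega>)) - (LINT \<omega>|M. iexp (u \<bullet> D (V n \<omega>)))) =
           norm (LINT \<omega>|M. iexp (u \<bullet> E n \<omega>) - iexp (u \<bullet> D (V n \<omega>)))"
          using i1 by simp
        also have "\<dots> \<le> (LINT \<omega>|M. norm (iexp (u \<bullet> E n \<omega>) - iexp (u \<bullet> D (V n \<omega>))))"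
          by (rule integral_norm_bound)
        also have "\<dots> \<le> (LINT \<omega>|M. norm u * \<eta> * (1 + (norm (V n \<omega>))\<^sup>2) + 2 / (\<delta>\<^sup>2 * real n) * (norm (V n \<omega>))\<^sup>2)"
          using i1 iV(1) bound by (intro integral_mono) auto
        also have "\<dots> = norm u * \<eta> * (1 + expectation (\<lambda>\<omega>. (norm (V n \<omega>))\<^sup>2)) + 2 / (\<delta>\<^sup>2 * real n) * expectation (\<lambda>\<omega>. (norm (V n \<omega>))\<^sup>2)"
          using iV(1) prob_space by simp
        also have "\<dots> \<le> norm u * \<eta> * (1 + dispersion) + 2 / (\<delta>\<^sup>2 * real n) * dispersion"
          using iV(2) \<eta> by (intro add_mono mult_left_mono) auto
        also have "\<dots> < r / 2 + r / 2"
        proof (rule add_le_less_mono[OF \<eta>2])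
          have "4 * dispersion / (\<delta>\<^sup>2 * r) < real n" using n0 n by simp
          then show "2 / (\<delta>\<^sup>2 * real n) * dispersion < r / 2" using np \<delta>(1) r by (simp add: field_simps)
        qed
        finally show ?thesis by simp
      qed
      then show "\<exists>no. \<forall>n\<ge>no. norm ((LINT \<omega>|M. iexp (u \<bullet> E n \<omega>)) - (LINT \<omega>|M. iexp (u \<bullet> D (V n \<omega>))) - 0) < r"
        by blast
    qed
    from tendsto_add[OF this lim]
    have "(\<lambda>n. LINT \<omega>|M. iexp (u \<bullet> E n \<omega>)) \<longlonglongrightarrow> (LINT x|N. iexp (u \<bullet> x))" by simp
    then show "(\<lambda>n. LINT x|distr M borel (E n). iexp (u \<bullet> x)) \<longlonglongrightarrow> (LINT x|N. iexp (u \<bullet> x))"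
      by (simp add: integral_distr)
  qed (use N in \<open>auto simp: normal_distribution_def intro!: prob_space_distr\<close>)
  then show ?thesis using \<Sigma> N unfolding E_def by blast
qed

end


section \<open>Moments of the Cauchy mixture\<close>

lemma cauchy_mixture_density_eq:
  "cauchy_mixture_density t \<mu>1 \<sigma>1 \<mu>2 \<sigma>2 x =
    (1 - t) / pi * poisson_kernel \<mu>1 \<sigma>1 x + t / pi * poisson_kernel \<mu>2 \<sigma>2 x"
  by (simp add: cauchy_mixture_density_def poisson_kernel_def)

lemma cauchy_mixture_integral:
  fixes f :: "real \<Rightarrow> 'b::{banach, second_countable_topology}"
  assumes X: "distributed M lborel X (\<lambda>x. ennreal (cauchy_mixture_density t \<mu>1 \<sigma>1 \<mu>2 \<sigma>2 x))"
    and t: "0 \<le> t" "t \<le> 1" and \<sigma>: "\<sigma>1 > 0" "\<sigma>2 > 0"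
    and f[measurable]: "f \<in> borel_measurable borel"
    and i1: "integrable lborel (\<lambda>x. poisson_kernel \<mu>1 \<sigma>1 x *\<^sub>R f x)"
    and i2: "integrable lborel (\<lambda>x. poisson_kernel \<mu>2 \<sigma>2 x *\<^sub>R f x)"
  shows "integrable M (\<lambda>\<omega>. f (X \<omega>))"
    and "(LINT \<omega>|M. f (X \<omega>)) = ((1 - t) / pi) *\<^sub>R (LINT x|lborel. poisson_kernel \<mu>1 \<sigma>1 x *\<^sub>R f x)
      + (t / pi) *\<^sub>R (LINT x|lborel. poisson_kernel \<mu>2 \<sigma>2 x *\<^sub>R f x)"
proof -
  let ?d = "cauchy_mixture_density t \<mu>1 \<sigma>1 \<mu>2 \<sigma>2"
  have Xm: "X \<in> measurable M lborel" using X by (rule distributed_measurable)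
  have dm[measurable]: "?d \<in> borel_measurable borel" 
    unfolding cauchy_mixture_density_def by measurable
  have nn: "?d x \<ge> 0" for x
    unfolding cauchy_mixture_density_eq using t \<sigma> poisson_kernel_nonneg by simp
  have eq: "?d x *\<^sub>R f x = ((1 - t) / pi) *\<^sub>R (poisson_kernel \<mu>1 \<sigma>1 x *\<^sub>R f x) + (t / pi) *\<^sub>R (poisson_kernel \<mu>2 \<sigma>2 x *\<^sub>R f x)" for x
    by (simp add: cauchy_mixture_density_eq scaleR_add_left)
  have i: "integrable lborel (\<lambda>x. ?d x *\<^sub>R f x)" unfolding eq
    by (intro Bochner_Integration.integrable_add integrable_scaleR_right i1 i2)
  then have "integrable (density lborel ?d) f"
    by (subst integrable_density) (auto simp: nn)
  then have "integrable (distr M lborel X) f"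
    by (simp add: distributed_distr_eq_density[OF X])
  then show "integrable M (\<lambda>\<omega>. f (X \<omega>))"
    by (subst (asm) integrable_distr_eq[OF Xm]) auto
  have "(LINT \<omega>|M. f (X \<omega>)) = (LINT x|distr M lborel X. f x)"
    by (rule integral_distr[OF Xm, symmetric]) auto
  also have "\<dots> = (LINT x|lborel. ?d x *\<^sub>R f x)"
    unfolding distributed_distr_eq_density[OF X] by (rule integral_density) (auto simp: nn)
  also have "\<dots> = ((1 - t) / pi) *\<^sub>R (LINT x|lborel. poisson_kernel \<mu>1 \<sigma>1 x *\<^sub>R f x)
      + (t / pi) *\<^sub>R (LINT x|lborel. poisson_kernel \<mu>2 \<sigma>2 x *\<^sub>R f x)"
    unfolding eq
    by (subst Bochner_Integration.integral_add) (auto intro!: integrable_scaleR_right i1 i2 simp del: scaleR_scaleR)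
  finally show "(LINT \<omega>|M. f (X \<omega>)) = ((1 - t) / pi) *\<^sub>R (LINT x|lborel. poisson_kernel \<mu>1 \<sigma>1 x *\<^sub>R f x)
      + (t / pi) *\<^sub>R (LINT x|lborel. poisson_kernel \<mu>2 \<sigma>2 x *\<^sub>R f x)" .
qed

lemma cauchy_mixture_power_moment:
  assumes X: "distributed M lborel X (\<lambda>x. ennreal (cauchy_mixture_density t \<mu>1 \<sigma>1 \<mu>2 \<sigma>2 x))"
    and t: "0 \<le> t" "t \<le> 1" and \<sigma>: "\<sigma>1 > 0" "\<sigma>2 > 0" and q: "0 < q" "q < 1"
  shows "integrable M (\<lambda>\<omega>. cpow (X \<omega>) q)"
    and "(LINT \<omega>|M. cpow (X \<omega>) q) =
      (1 - of_real t) * Complex \<mu>1 \<sigma>1 powr of_real q + of_real t * Complex \<mu>2 \<sigma>2 powr of_real q"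
proof -
  note mix = cauchy_mixture_integral[OF X t \<sigma> cpow_measurable integrable_poisson_cpow[OF q \<sigma>(1)] integrable_poisson_cpow[OF q \<sigma>(2)]]
  show "integrable M (\<lambda>\<omega>. cpow (X \<omega>) q)" by (rule mix(1))
  show "(LINT \<omega>|M. cpow (X \<omega>) q) =
      (1 - of_real t) * Complex \<mu>1 \<sigma>1 powr of_real q + of_real t * Complex \<mu>2 \<sigma>2 powr of_real q"
    unfolding mix(2) integral_poisson_cpow[OF q \<sigma>(1)] integral_poisson_cpow[OF q \<sigma>(2)]
    by (simp add: scaleR_conv_of_real)
qed

text \<open>\<open>|x\<^sup>q|\<^sup>2 = |x\<^sup>2\<^sup>q|\<close>, and \<open>2 q < 1\<close>.\<close>

lemma cauchy_mixture_square_moment: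
  assumes X: "distributed M lborel X (\<lambda>x. ennreal (cauchy_mixture_density t \<mu>1 \<sigma>1 \<mu>2 \<sigma>2 x))"
    and t: "0 \<le> t" "t \<le> 1" and \<sigma>: "\<sigma>1 > 0" "\<sigma>2 > 0" and q: "0 < q" "q < 1 / 2"
  shows "integrable M (\<lambda>\<omega>. (norm (cpow (X \<omega>) q))\<^sup>2)"
proof -
  have eq: "(norm (cpow x q))\<^sup>2 = norm (cpow x (2 * q))" for x
    by (simp add: norm_cpow powr_add[symmetric] power2_eq_square)
  show ?thesis unfolding eq
    by (rule integrable_norm[OF cauchy_mixture_power_moment(1)[OF X t \<sigma>]]) (use q in auto)
qed

definition power_vector :: "real \<Rightarrow> real \<Rightarrow> complex \<times> complex \<times> complex" where
  "power_vector \<alpha> x = (cpow x \<alpha>, cpow x (2 * \<alpha>), cpow x (3 * \<alpha>))"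

lemma power_vector_measurable [measurable]: "power_vector \<alpha> \<in> borel_measurable borel"
  unfolding power_vector_def[abs_def] by (intro borel_measurable_Pair) measurable

lemma norm_power_vector:
  "(norm (power_vector \<alpha> x))\<^sup>2 = (norm (cpow x \<alpha>))\<^sup>2 + ((norm (cpow x (2 * \<alpha>)))\<^sup>2 + (norm (cpow x (3 * \<alpha>)))\<^sup>2)"
  by (simp add: power_vector_def norm_Pair)

lemma complex_powr_of_nat_mult:
  assumes "(z::complex) \<noteq> 0"
  shows "z powr (of_real (real j * \<alpha>)) = (z powr of_real \<alpha>) ^ j"
  using assms by (simp add: powr_def exp_of_nat_mult[symmetric] mult.assoc)


section \<open>Inversion of the moment map\<close>

text \<open>The first three moments of the distribution with mass \<open>1 - t\<close> at \<open>a\<close> and \<open>t\<close> at \<open>b\<close>.\<close>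

definition mixture_moments :: "complex \<Rightarrow> complex \<Rightarrow> complex \<Rightarrow> complex \<times> complex \<times> complex" where
  "mixture_moments t a b = ((1 - t) * a + t * b, (1 - t) * a ^ 2 + t * b ^ 2, (1 - t) * a ^ 3 + t * b ^ 3)"

text \<open>
  The variance factor \<open>x2 - x1\<^sup>2\<close> is common to all three expressions; the quotients are the
  elementary symmetric functions of \<open>a\<close> and \<open>b\<close>.
\<close>

lemma mixture_moments_identities:
  fixes t a b :: complex
  defines "x1 \<equiv> (1 - t) * a + t * b" and "x2 \<equiv> (1 - t) * a ^ 2 + t * b ^ 2" and "x3 \<equiv> (1 - t) * a ^ 3 + t * b ^ 3"
  shows "x2 - x1\<^sup>2 = t * (1 - t) * (a - b)\<^sup>2"
    and "x3 - x1 * x2 = (a + b) * (x2 - x1\<^sup>2)"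
    and "x1 * x3 - x2\<^sup>2 = (a * b) * (x2 - x1\<^sup>2)"
  unfolding x1_def x2_def x3_def by algebra+

context
  fixes t a b :: complex and x1 x2 x3 :: complex
  assumes t: "t \<noteq> 0" "t \<noteq> 1" and ab: "a \<noteq> b"
    and mm: "mixture_moments t a b = (x1, x2, x3)"
begin

lemma mixture_variance: "x2 - x1\<^sup>2 = t * (1 - t) * (a - b)\<^sup>2" "x2 - x1\<^sup>2 \<noteq> 0"
proof -
  show *: "x2 - x1\<^sup>2 = t * (1 - t) * (a - b)\<^sup>2"
    using mm mixture_moments_identities[of t a b] unfolding mixture_moments_def prod.inject by auto
  show "x2 - x1\<^sup>2 \<noteq> 0" unfolding * using t ab by simp
qed

lemma F1_mixture: "F1 (mixture_moments t a b) = (a + b) / 2"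
proof -
  have "x3 - x1 * x2 = (a + b) * (x2 - x1\<^sup>2)"
    using mm mixture_moments_identities[of t a b] unfolding mixture_moments_def prod.inject by auto
  then have "F1 (x1, x2, x3) = ((a + b) * (x2 - x1\<^sup>2)) / (2 * (x2 - x1\<^sup>2))" by (simp only: F1_def prod.case)
  also have "\<dots> = (a + b) / 2" by (rule nonzero_mult_divide_mult_cancel_right[OF mixture_variance(2)])
  finally show ?thesis by (simp only: mm)
qed

lemma F2_mixture: "F2 (mixture_moments t a b) = ((a - b) / 2)\<^sup>2"
proof -
  have "x1 * x3 - x2\<^sup>2 = (a * b) * (x2 - x1\<^sup>2)"
    using mm mixture_moments_identities[of t a b] unfolding mixture_moments_def prod.inject by auto
  then have "(x1 * x3 - x2\<^sup>2) / (x2 - x1\<^sup>2) = a * b" using mixture_variance(2) by simp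
  then have "F2 (mixture_moments t a b) = ((a + b) / 2)\<^sup>2 - a * b"
    using F1_mixture unfolding mm F2_def prod.case by (simp only:)
  also have "\<dots> = ((a - b) / 2)\<^sup>2" by (simp add: power2_eq_square field_simps)
  finally show ?thesis .
qed

lemma F3_F4_mixture:
  "a = F3 (mixture_moments t a b) \<and> b = F4 (mixture_moments t a b) \<or>
   b = F3 (mixture_moments t a b) \<and> a = F4 (mixture_moments t a b)"
proof -
  have "(csqrt (((a - b) / 2)\<^sup>2))\<^sup>2 = ((a - b) / 2)\<^sup>2" by simp
  then have "csqrt (((a - b) / 2)\<^sup>2) = (a - b) / 2 \<or> csqrt (((a - b) / 2)\<^sup>2) = - ((a - b) / 2)"
    by (simp only: power2_eq_iff)
  then show ?thesis unfolding F3_def F4_def F1_mixture F2_mixture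
    by (auto simp: field_simps)
qed

lemma F5_mixture:
  assumes "a \<noteq> 0" "b \<noteq> 0"
  shows "F5 (mixture_moments t a b) = a / b + b / a"
    and "(F1 (mixture_moments t a b))\<^sup>2 - F2 (mixture_moments t a b) = a * b"
proof -
  show *: "(F1 (mixture_moments t a b))\<^sup>2 - F2 (mixture_moments t a b) = a * b"
    unfolding F1_mixture F2_mixture by (simp add: power2_eq_square field_simps)
  show "F5 (mixture_moments t a b) = a / b + b / a"
    unfolding F5_def * unfolding F1_mixture using assms by (simp add: power2_eq_square field_simps)
qed

lemma F6_mixture:
  assumes "a \<noteq> 0" "b \<noteq> 0"
  shows "F6 (mixture_moments t a b) = (a / b - b / a)\<^sup>2"
proof -
  have "(r + s)\<^sup>2 - 4 = (r - s)\<^sup>2" if "r * s = 1" for r s :: complex using that by algebra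
  then show ?thesis unfolding F6_def F5_mixture(1)[OF assms] using assms by simp
qed

text \<open>
  The principal root lies in the closed right half plane and, on the imaginary axis, in its upper
  half; a labelling by \<open>F3\<close> therefore orders the imaginary parts when the real parts agree.
\<close>

lemma F3_eq_imp:
  assumes "a = F3 (mixture_moments t a b)"
  shows "csqrt (((a - b) / 2)\<^sup>2) = (a - b) / 2" "Re (a - b) = 0 \<Longrightarrow> Im (a - b) > 0"
proof -
  have "a = (a + b) / 2 + csqrt (((a - b) / 2)\<^sup>2)"
    using assms unfolding F3_def F1_mixture F2_mixture .
  then show *: "csqrt (((a - b) / 2)\<^sup>2) = (a - b) / 2" by (simp add: field_simps)
  assume "Re (a - b) = 0"
  then show "Im (a - b) > 0" using csqrt_principal[of "((a - b) / 2)\<^sup>2"] ab unfolding * 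
    by (auto simp: complex_eq_iff)
qed

end


section \<open>Powers and ratios in the first quadrant\<close>

text \<open>
  For \<open>\<alpha> < 1/2\<close> the power has argument in \<open>(0, \<pi>/2)\<close>, so \<open>Ln (z\<^sup>\<alpha>) = \<alpha> Ln z\<close> without a correction
  by \<open>2 \<pi> i\<close>.
\<close>

lemma upper_half_plane_powr:
  assumes z: "Im z > 0" and \<alpha>: "0 < \<alpha>" "\<alpha> < 1 / 2"
  shows "Re (z powr of_real \<alpha>) > 0" "Im (z powr of_real \<alpha>) > 0"
    and "(z powr of_real \<alpha>) powr of_real (1 / \<alpha>) = z"
    and "norm (z powr of_real \<alpha>) = norm z powr \<alpha>"
proof -
  have nz: "z \<noteq> 0" using z by auto
  have Ln: "0 < Im (Ln z)" "Im (Ln z) < pi" using Im_Ln_pos_lt_imp[OF z] by auto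
  have eq: "z powr of_real \<alpha> = exp (of_real \<alpha> * Ln z)" using nz by (simp add: powr_def)
  have "\<alpha> * Im (Ln z) < (1 / 2) * pi"
    using Ln \<alpha> by (intro mult_strict_mono) auto
  then have im: "0 < \<alpha> * Im (Ln z)" "\<alpha> * Im (Ln z) < pi / 2" using Ln \<alpha> by auto
  show "Re (z powr of_real \<alpha>) > 0" unfolding eq using im by (simp add: Re_exp cos_gt_zero)
  show "Im (z powr of_real \<alpha>) > 0" unfolding eq using im pi_gt_zero by (simp add: Im_exp sin_gt_zero)
  have "Ln (z powr of_real \<alpha>) = of_real \<alpha> * Ln z"
    unfolding eq using im pi_gt_zero by (intro Ln_exp) auto
  then have "(z powr of_real \<alpha>) powr of_real (1 / \<alpha>) = exp (of_real (1 / \<alpha>) * (of_real \<alpha> * Ln z))"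
    using eq by (subst powr_def) simp
  also have "of_real (1 / \<alpha>) * (of_real \<alpha> * Ln z) = Ln z" using \<alpha> by simp
  finally show "(z powr of_real \<alpha>) powr of_real (1 / \<alpha>) = z" using nz by simp
  show "norm (z powr of_real \<alpha>) = norm z powr \<alpha>" by (simp add: norm_powr_real_powr')
qed

text \<open>
  Both \<open>a / b\<close> and \<open>b / a\<close> have real part \<open>Re (a cnj b) > 0\<close> up to the factors \<open>1 / |b|\<^sup>2\<close> and
  \<open>1 / |a|\<^sup>2\<close>.
\<close>

lemma Re_ratio_difference_pos:
  assumes "Re a > 0" "Re b > 0" "Im a > 0" "Im b > 0" and less: "norm b < norm a"
  shows "Re (a / b - b / a) > 0"
proof -
  have b: "(norm b)\<^sup>2 > 0" using assms by auto
  have lt: "(norm b)\<^sup>2 < (norm a)\<^sup>2" using less by (intro power_strict_mono) auto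
  have c: "Re (a * cnj b) > 0" using assms by (simp add: add_pos_pos)
  have "Re (b / a) = Re (a * cnj b) / (norm a)\<^sup>2"
    by (subst complex_div_cnj) (simp add: Re_divide_of_real algebra_simps flip: of_real_power)
  also have "\<dots> < Re (a * cnj b) / (norm b)\<^sup>2"
    using c b lt by (intro divide_strict_left_mono mult_pos_pos) auto
  also have "\<dots> = Re (a / b)"
    by (subst complex_div_cnj[of a b]) (simp add: flip: of_real_power)
  finally show ?thesis by simp
qed

lemma power2_notin_nonpos_Reals: "Re c \<noteq> 0 \<Longrightarrow> c\<^sup>2 \<notin> \<real>\<^sub>\<le>\<^sub>0"
  by (auto simp: complex_nonpos_Reals_iff power2_eq_square mult_le_0_iff)


section \<open>Measurability and differentiability of the closed forms\<close>

lemma differentiable_field_compose: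
  fixes f :: "'x::real_normed_vector \<Rightarrow> complex"
  assumes "f differentiable (at x)" "h field_differentiable (at (f x))"
  shows "(\<lambda>x. h (f x)) differentiable (at x)"
  using differentiable_chain_at[OF assms(1) field_differentiable_imp_differentiable[OF assms(2)]]
  by (simp add: comp_def)

lemma F_prod_eq:
  "F1 x = (snd (snd x) - fst x * fst (snd x)) / (2 * (fst (snd x) - (fst x)\<^sup>2))"
  "F2 x = (F1 x)\<^sup>2 - (fst x * snd (snd x) - (fst (snd x))\<^sup>2) / (fst (snd x) - (fst x)\<^sup>2)"
  by (simp_all add: F1_def F2_def case_prod_beta)

lemma csqrt_measurable [measurable]: "csqrt \<in> borel_measurable borel"
proof -
  have "csqrt = (\<lambda>z. if z = 0 then 0 else exp (Ln z / 2))"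
    by (auto simp: csqrt_exp_Ln)
  moreover have "(\<lambda>z. if z = 0 then 0 else exp (Ln z / 2)) \<in> borel_measurable borel" by measurable
  ultimately show ?thesis by metis
qed

lemma F_measurable [measurable]:
  "F1 \<in> borel_measurable borel" "F2 \<in> borel_measurable borel" "F3 \<in> borel_measurable borel"
  "F4 \<in> borel_measurable borel" "F5 \<in> borel_measurable borel" "F6 \<in> borel_measurable borel"
proof -
  have [measurable]: "(fst :: complex \<times> complex \<times> complex \<Rightarrow> _) \<in> borel_measurable borel"
    "(snd :: complex \<times> complex \<times> complex \<Rightarrow> _) \<in> borel_measurable borel"
    "(fst :: complex \<times> complex \<Rightarrow> _) \<in> borel_measurable borel"
    "(snd :: complex \<times> complex \<Rightarrow> _) \<in> borel_measurable borel"
    by (intro borel_measurable_continuous_onI continuous_intros)+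
  show 1[measurable]: "F1 \<in> borel_measurable borel" unfolding F_prod_eq(1)[abs_def] by measurable
  show 2[measurable]: "F2 \<in> borel_measurable borel" unfolding F_prod_eq(2)[abs_def] by measurable
  show "F3 \<in> borel_measurable borel" unfolding F3_def[abs_def] by measurable
  show "F4 \<in> borel_measurable borel" unfolding F4_def[abs_def] by measurable
  show 5[measurable]: "F5 \<in> borel_measurable borel" unfolding F5_def[abs_def] by measurable
  show "F6 \<in> borel_measurable borel" unfolding F6_def[abs_def] by measurable
qed

lemma ratio_est_measurable [measurable]: "ratio_est \<in> borel_measurable borel"
  unfolding ratio_est_def[abs_def] by measurable

lemma a1_est_measurable [measurable]: "a1_est \<in> borel_measurable borel"
  unfolding a1_est_def[abs_def] by measurable

lemma a2_est_measurable [measurable]: "a2_est \<in> borel_measurable borel"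
  unfolding a2_est_def[abs_def] by measurable

lemma differentiable_fst_snd [simp]:
  "fst differentiable (at x)" "(\<lambda>x. fst (snd x)) differentiable (at x)" "(\<lambda>x. snd (snd x)) differentiable (at x)"
  by (intro bounded_linear_imp_differentiable bounded_linear_intros
     bounded_linear_compose[OF bounded_linear_fst bounded_linear_snd] bounded_linear_compose[OF bounded_linear_snd bounded_linear_snd] bounded_linear_fst)+

text \<open>
  In the following lemmas the hypotheses say that no denominator vanishes at \<open>x\<close> and that no
  argument of a square root lies on the branch cut.
\<close>

lemma F1_F2_differentiable:
  assumes "fst (snd x) - (fst x)\<^sup>2 \<noteq> 0"
  shows "F1 differentiable (at x)" "F2 differentiable (at x)"
proof -
  show 1: "F1 differentiable (at x)" unfolding F_prod_eq(1)[abs_def]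
    using assms by (intro derivative_intros differentiable_fst_snd) auto
  show "F2 differentiable (at x)" unfolding F_prod_eq(2)[abs_def]
    using assms by (intro derivative_intros differentiable_fst_snd 1) auto
qed

lemma F3_F4_differentiable:
  assumes "fst (snd x) - (fst x)\<^sup>2 \<noteq> 0" "F2 x \<notin> \<real>\<^sub>\<le>\<^sub>0"
  shows "F3 differentiable (at x)" "F4 differentiable (at x)"
  unfolding F3_def[abs_def] F4_def[abs_def]
  by (intro differentiable_add differentiable_diff F1_F2_differentiable[OF assms(1)]
      differentiable_field_compose[of _ _ csqrt] field_differentiable_at_csqrt assms(2))+

lemma ratio_est_differentiable:
  assumes "fst (snd x) - (fst x)\<^sup>2 \<noteq> 0" "(F1 x)\<^sup>2 - F2 x \<noteq> 0" "F6 x \<notin> \<real>\<^sub>\<le>\<^sub>0"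
  shows "ratio_est differentiable (at x)"
proof -
  note 12 = F1_F2_differentiable[OF assms(1)]
  have 5: "F5 differentiable (at x)" unfolding F5_def[abs_def]
    using 12 assms(2) by (intro derivative_intros) auto
  have "F6 differentiable (at x)" unfolding F6_def[abs_def]
    by (intro derivative_intros 5)
  then have "(\<lambda>x. csqrt (F6 x)) differentiable (at x)"
    by (rule differentiable_field_compose) (intro field_differentiable_at_csqrt assms)
  with 5 show ?thesis unfolding ratio_est_def[abs_def] by (intro derivative_intros) auto
qed

lemma a1_est_differentiable:
  assumes "fst (snd x) - (fst x)\<^sup>2 \<noteq> 0" "(F1 x)\<^sup>2 - F2 x \<noteq> 0" "F6 x \<notin> \<real>\<^sub>\<le>\<^sub>0" "1 + ratio_est x \<noteq> 0"
  shows "a1_est differentiable (at x)" "a2_est differentiable (at x)"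
proof -
  show 1: "a1_est differentiable (at x)" unfolding a1_est_def[abs_def]
    using F1_F2_differentiable[OF assms(1)] ratio_est_differentiable[OF assms(1-3)] assms(4)
    by (intro derivative_intros) auto
  show "a2_est differentiable (at x)" unfolding a2_est_def[abs_def]
    by (intro derivative_intros 1 ratio_est_differentiable assms)
qed


section \<open>Convergence of the unordered pair of roots\<close>

lemma hausdorff_dist_le:
  fixes S T :: "'a::metric_space set"
  assumes "finite S" "finite T" "S \<noteq> {}" "T \<noteq> {}"
    and "\<And>x. x \<in> S \<Longrightarrow> \<exists>y\<in>T. dist x y \<le> e" "\<And>y. y \<in> T \<Longrightarrow> \<exists>x\<in>S. dist y x \<le> e"
  shows "0 \<le> hausdorff_dist S T" "hausdorff_dist S T \<le> e"
proof -
  show "hausdorff_dist S T \<le> e" unfolding hausdorff_dist_def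
    using assms by (intro max.boundedI cSUP_least) (auto intro: order_trans[OF infdist_le])
  obtain x where x: "x \<in> S" using assms by auto
  have "0 \<le> infdist x T" by (rule infdist_nonneg)
  also have "\<dots> \<le> (SUP x\<in>S. infdist x T)"
    using assms(1) x by (intro cSUP_upper bdd_above_finite) auto
  finally show "0 \<le> hausdorff_dist S T" unfolding hausdorff_dist_def by simp
qed

text \<open>
  The product of the distances of \<open>s\<close> to \<open>d\<close> and to \<open>-d\<close> is \<open>|s\<^sup>2 - d\<^sup>2|\<close>, so one of them is at most
  the square root of that. The bound involves only the squares, hence no choice of a branch.
\<close>

lemma hausdorff_dist_plus_minus:
  fixes m s m0 d :: complex
  shows "0 \<le> hausdorff_dist {m + s, m - s} {m0 + d, m0 - d}"
    and "hausdorff_dist {m + s, m - s} {m0 + d, m0 - d} \<le> norm (m - m0) + sqrt (norm (s\<^sup>2 - d\<^sup>2))"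
proof -
  define e where "e = norm (m - m0) + sqrt (norm (s\<^sup>2 - d\<^sup>2))"
  have prod: "norm (s\<^sup>2 - d\<^sup>2) = norm (s - d) * norm (s + d)"
    by (simp add: norm_mult[symmetric] power2_eq_square algebra_simps)
  have near: "norm (m - m0) + norm r \<le> e" if "norm r * norm r \<le> norm (s\<^sup>2 - d\<^sup>2)" for r :: complex
    using real_le_rsqrt[of "norm r" "norm (s\<^sup>2 - d\<^sup>2)"] that by (simp add: e_def power2_eq_square)
  have "\<exists>s'\<in>{s, - s}. norm (m - m0) + norm (s' - d) \<le> e"
  proof (cases "norm (s - d) \<le> norm (s + d)")
    case True
    then show ?thesis using near[of "s - d"] by (auto simp: prod mult_left_mono)
  next
    case False
    then have "norm (m - m0) + norm (s + d) \<le> e" by (intro near) (auto simp: prod mult_right_mono)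
    moreover have "norm (- s - d) = norm (s + d)" by (metis minus_add_distrib norm_minus_cancel diff_conv_add_uminus)
    ultimately show ?thesis by simp
  qed
  then obtain s' where s': "s' \<in> {s, - s}" "norm (m - m0) + norm (s' - d) \<le> e" by blast
  have S: "{m + s, m - s} = {m + s', m - s'}" using s'(1) by auto
  have 1: "dist (m + s') (m0 + d) \<le> e"
    using norm_triangle_ineq[of "m - m0" "s' - d"] s'(2) by (simp add: dist_norm algebra_simps)
  have 2: "dist (m - s') (m0 - d) \<le> e"
    using norm_triangle_ineq4[of "m - m0" "s' - d"] s'(2) by (simp add: dist_norm algebra_simps)
  have "0 \<le> hausdorff_dist {m + s, m - s} {m0 + d, m0 - d} \<and> hausdorff_dist {m + s, m - s} {m0 + d, m0 - d} \<le> e"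
    unfolding S by (intro conjI hausdorff_dist_le[of _ _ e]) (use 1 2 in \<open>auto simp: dist_commute\<close>)
  then show "0 \<le> hausdorff_dist {m + s, m - s} {m0 + d, m0 - d}"
    and "hausdorff_dist {m + s, m - s} {m0 + d, m0 - d} \<le> norm (m - m0) + sqrt (norm (s\<^sup>2 - d\<^sup>2))"
    unfolding e_def by auto
qed


section \<open>Plug-in estimators\<close>

context iid_square_integrable
begin

lemma consistent_differentiable:
  fixes g :: "'b \<Rightarrow> 'c::{real_normed_vector, second_countable_topology}"
  assumes "g \<in> borel_measurable borel" "g differentiable (at mean)" "g mean = \<theta>"
  shows "strongly_consistent M (\<lambda>n \<omega>. g (average n \<omega>)) \<theta> \<and> sqrt_n_consistent M (\<lambda>n \<omega>. g (average n \<omega>)) \<theta>"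
  using strongly_consistent_continuous[OF assms(1) differentiable_imp_continuous_within[OF assms(2)]]
    sqrt_n_consistent_differentiable[OF assms(1,2)] assms(3) by simp

end

lemma differentiable_Re_Im:
  assumes "f differentiable (at x)"
  shows "(\<lambda>x. Re (f x)) differentiable (at x)" "(\<lambda>x. Im (f x)) differentiable (at x)"
  using differentiable_chain_at[OF assms bounded_linear_imp_differentiable[OF bounded_linear_Re]]
    differentiable_chain_at[OF assms bounded_linear_imp_differentiable[OF bounded_linear_Im]]
  by (simp_all add: comp_def)

text \<open>
  Each plug-in estimator is itself a function of the average that is differentiable at the mean: the
  denominator \<open>b1 - b2\<close> does not vanish there, and the powers are taken off the branch cut.
\<close>

lemma consistent_plug_in_differentiable:
  fixes Z :: "nat \<Rightarrow> 'a \<Rightarrow> complex \<times> complex \<times> complex"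
  assumes iid: "iid_square_integrable M Z" and B: "iid_square_integrable.mean M Z = B"
    and b[measurable]: "b1 \<in> borel_measurable borel" "b2 \<in> borel_measurable borel"
    and d: "b1 differentiable (at B)" "b2 differentiable (at B)"
    and ne: "b1 B \<noteq> b2 B" "b1 B \<notin> \<real>\<^sub>\<le>\<^sub>0" "b2 B \<notin> \<real>\<^sub>\<le>\<^sub>0"
    and t: "complex_of_real t = (b1 B - fst B) / (b1 B - b2 B)"
    and z: "Complex \<mu>1 \<sigma>1 = b1 B powr of_real (1 / \<alpha>)" "Complex \<mu>2 \<sigma>2 = b2 B powr of_real (1 / \<alpha>)"
  shows "consistent_plug_in M \<alpha> (\<lambda>n \<omega>. fst (iid_square_integrable.average Z n \<omega>))
    (\<lambda>n \<omega>. b1 (iid_square_integrable.average Z n \<omega>)) (\<lambda>n \<omega>. b2 (iid_square_integrable.average Z n \<omega>)) t \<mu>1 \<sigma>1 \<mu>2 \<sigma>2"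
proof -
  interpret iid_square_integrable M Z by fact
  have [measurable]: "(fst :: complex \<times> complex \<times> complex \<Rightarrow> _) \<in> borel_measurable borel"
    by (intro borel_measurable_continuous_onI continuous_intros)
  define gt where "gt x = (b1 x - fst x) / (b1 x - b2 x)" for x
  define gz where "gz b x = b x powr complex_of_real (1 / \<alpha>)" for b and x :: "complex \<times> complex \<times> complex"
  have gt: "gt \<in> borel_measurable borel" "gt differentiable (at B)" "gt B = of_real t"
    unfolding gt_def[abs_def] using t ne(1) d by (auto intro!: derivative_intros)
  have gz: "gz b differentiable (at B)" if "b differentiable (at B)" "b B \<notin> \<real>\<^sub>\<le>\<^sub>0" for b
    unfolding gz_def using that has_field_derivative_powr field_differentiable_def
    by (intro differentiable_field_compose[of _ _ "\<lambda>z. z powr complex_of_real (1 / \<alpha>)"]) blast+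
  have gzm[measurable]: "gz b1 \<in> borel_measurable borel" "gz b2 \<in> borel_measurable borel"
    unfolding gz_def[abs_def] by measurable
  have gzB: "gz b1 B = Complex \<mu>1 \<sigma>1" "gz b2 B = Complex \<mu>2 \<sigma>2" by (simp_all add: gz_def z)
  note cons = consistent_differentiable[unfolded B]
  note gz12 = gz[OF d(1) ne(2)] gz[OF d(2) ne(3)]
  have 1: "strongly_consistent M (\<lambda>n \<omega>. gt (average n \<omega>)) (of_real t) \<and> sqrt_n_consistent M (\<lambda>n \<omega>. gt (average n \<omega>)) (of_real t)"
    by (rule cons[OF gt])
  have 2: "strongly_consistent M (\<lambda>n \<omega>. Re (gt (average n \<omega>))) t \<and> sqrt_n_consistent M (\<lambda>n \<omega>. Re (gt (average n \<omega>))) t"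
    by (rule cons[of "\<lambda>x. Re (gt x)"]) (use gt in \<open>auto intro: differentiable_Re_Im\<close>)
  have 3: "strongly_consistent M (\<lambda>n \<omega>. Re (gz b1 (average n \<omega>))) \<mu>1 \<and> sqrt_n_consistent M (\<lambda>n \<omega>. Re (gz b1 (average n \<omega>))) \<mu>1"
    by (rule cons[of "\<lambda>x. Re (gz b1 x)"]) (use gz12 in \<open>auto intro: differentiable_Re_Im simp: gzB\<close>)
  have 4: "strongly_consistent M (\<lambda>n \<omega>. Im (gz b1 (average n \<omega>))) \<sigma>1 \<and> sqrt_n_consistent M (\<lambda>n \<omega>. Im (gz b1 (average n \<omega>))) \<sigma>1"
    by (rule cons[of "\<lambda>x. Im (gz b1 x)"]) (use gz12 in \<open>auto intro: differentiable_Re_Im simp: gzB\<close>)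
  have 5: "strongly_consistent M (\<lambda>n \<omega>. Re (gz b2 (average n \<omega>))) \<mu>2 \<and> sqrt_n_consistent M (\<lambda>n \<omega>. Re (gz b2 (average n \<omega>))) \<mu>2"
    by (rule cons[of "\<lambda>x. Re (gz b2 x)"]) (use gz12 in \<open>auto intro: differentiable_Re_Im simp: gzB\<close>)
  have 6: "strongly_consistent M (\<lambda>n \<omega>. Im (gz b2 (average n \<omega>))) \<sigma>2 \<and> sqrt_n_consistent M (\<lambda>n \<omega>. Im (gz b2 (average n \<omega>))) \<sigma>2"
    by (rule cons[of "\<lambda>x. Im (gz b2 x)"]) (use gz12 in \<open>auto intro: differentiable_Re_Im simp: gzB\<close>)
  have pt: "plug_in_t (\<lambda>n \<omega>. fst (average n \<omega>)) (\<lambda>n \<omega>. b1 (average n \<omega>)) (\<lambda>n \<omega>. b2 (average n \<omega>)) = (\<lambda>n \<omega>. gt (average n \<omega>))"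
    by (simp add: fun_eq_iff plug_in_t_def gt_def)
  have pz: "plug_in_loc_scale \<alpha> (\<lambda>n \<omega>. b (average n \<omega>)) = (\<lambda>n \<omega>. gz b (average n \<omega>))" for b
    by (simp add: fun_eq_iff plug_in_loc_scale_def gz_def)
  show ?thesis
    unfolding consistent_plug_in_def pt pz using 1 2 3 4 5 6 by simp
qed


section \<open>Closed-form estimators for the Cauchy mixture\<close>

lemma bounded_linear_to_R2: "bounded_linear to_R2"
proof -
  have "linear to_R2"
    by (rule linearI) (simp_all add: to_R2_def vec_eq_iff forall_2)
  then show ?thesis by (simp add: linear_conv_bounded_linear)
qed

theorem mainTheorem11:
  fixes M :: "'a measure" and X :: "nat \<Rightarrow> 'a \<Rightarrow> real"
    and t \<mu>1 \<mu>2 \<sigma>1 \<sigma>2 \<alpha> :: real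
    and a1 a2 B1 B2 B3 :: complex and B :: "complex \<times> complex \<times> complex"
    and Xbar :: "nat \<Rightarrow> 'a \<Rightarrow> complex \<times> complex \<times> complex"
    and a1hat a2hat :: "nat \<Rightarrow> 'a \<Rightarrow> complex"
  assumes "prob_space M"
    and "0 < t" "t < 1" "0 < \<sigma>1" "0 < \<sigma>2" "(\<mu>1, \<sigma>1) \<noteq> (\<mu>2, \<sigma>2)"
    and "prob_space.indep_vars M (\<lambda>_. borel) X UNIV"
    and "\<And>i. distributed M lborel (X i) (\<lambda>x. ennreal (cauchy_mixture_density t \<mu>1 \<sigma>1 \<mu>2 \<sigma>2 x))"
    and "0 < \<alpha>" "\<alpha> < 1 / 6"
    and "a1 = Complex \<mu>1 \<sigma>1 powr complex_of_real \<alpha>"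
    and "a2 = Complex \<mu>2 \<sigma>2 powr complex_of_real \<alpha>"
    and "B = moments M \<alpha> (X 0)" "B = (B1, B2, B3)"
    and "Xbar = sample_moments \<alpha> X"
    and "a1hat = (\<lambda>n \<omega>. F3 (Xbar n \<omega>))"
    and "a2hat = (\<lambda>n \<omega>. F4 (Xbar n \<omega>))"
  shows
    "(\<forall>j\<in>{1..3::nat}. integrable M (\<lambda>\<omega>. cpow (X 0 \<omega>) (real j * \<alpha>))) \<and>
     a1 \<noteq> a2 \<and>
     complex_of_real t = (a1 - B1) / (a1 - a2) \<and>
     Complex \<mu>1 \<sigma>1 = a1 powr complex_of_real (1 / \<alpha>) \<and>
     Complex \<mu>2 \<sigma>2 = a2 powr complex_of_real (1 / \<alpha>) \<and>
     (a1 = F3 B \<and> a2 = F4 B \<or> a2 = F3 B \<and> a1 = F4 B) \<and>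
     (a1 = F3 B \<and> a2 = F4 B \<longrightarrow>
        \<comment> \<open>(i)\<close>
        (AE \<omega> in M. (\<lambda>n. hausdorff_dist {a1hat n \<omega>, a2hat n \<omega>} {a1, a2}) \<longlonglongrightarrow> 0) \<and>
        \<comment> \<open>(ii)\<close>
        (Re (a1 - a2) \<noteq> 0 \<longrightarrow>
           (\<exists>\<Sigma>1 :: real ^ 2 ^ 2. \<exists>N. nonneg_definite \<Sigma>1 \<and> normal_distribution 0 \<Sigma>1 N \<and>
              weakly_converges
                (\<lambda>n. distr M borel (\<lambda>\<omega>. to_R2 (complex_of_real (sqrt (real n)) * (a1hat n \<omega> - a1)))) N) \<and>
           sqrt_n_consistent M a1hat a1 \<and>
           sqrt_n_consistent M a2hat a2) \<and>
        \<comment> \<open>(iii)\<close>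
        F5 B = a1 / a2 + a2 / a1 \<and>
        F6 B = (a1 / a2 - a2 / a1)\<^sup>2 \<and>
        (Re (a1 - a2) = 0 \<longrightarrow>
           norm a1 \<noteq> norm a2 \<and>
           F6 B \<notin> \<real>\<^sub>\<le>\<^sub>0 \<and>
           sqrt_n_consistent M (\<lambda>n \<omega>. ratio_est (Xbar n \<omega>)) (a2 / a1) \<and>
           a1 = (a1 + a2) / (1 + a2 / a1) \<and>
           sqrt_n_consistent M (\<lambda>n \<omega>. a1_est (Xbar n \<omega>)) a1) \<and>
        (norm a1 \<noteq> norm a2 \<longleftrightarrow> \<mu>1\<^sup>2 + \<sigma>1\<^sup>2 \<noteq> \<mu>2\<^sup>2 + \<sigma>2\<^sup>2) \<and>
        \<comment> \<open>(iv)\<close>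
        (Re (a1 - a2) \<noteq> 0 \<longrightarrow>
           consistent_plug_in M \<alpha> (\<lambda>n \<omega>. fst (Xbar n \<omega>)) a1hat a2hat t \<mu>1 \<sigma>1 \<mu>2 \<sigma>2) \<and>
        (Re (a1 - a2) = 0 \<longrightarrow>
           consistent_plug_in M \<alpha> (\<lambda>n \<omega>. fst (Xbar n \<omega>))
             (\<lambda>n \<omega>. a1_est (Xbar n \<omega>)) (\<lambda>n \<omega>. a2_est (Xbar n \<omega>)) t \<mu>1 \<sigma>1 \<mu>2 \<sigma>2))"
proof -
  interpret prob_space M by fact
  note t = assms(2,3) and \<sigma> = assms(4,5) and ne = assms(6) and indep = assms(7) and dist = assms(8)
    and \<alpha> = assms(9,10) and a1 = assms(11) and a2 = assms(12)
  note a1hat = assms(16) and a2hat = assms(17)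
  have t': "0 \<le> t" "t \<le> 1" and tc: "complex_of_real t \<noteq> 0" "complex_of_real t \<noteq> 1" using t by auto
  have \<alpha>': "\<alpha> < 1 / 2" using \<alpha> by simp

  define Z where "Z i \<omega> = power_vector \<alpha> (X i \<omega>)" for i \<omega>
  have Xm[measurable]: "X i \<in> borel_measurable M" for i
    using distributed_measurable[OF dist[of i]] by simp
  have ident: "distr M borel (X i) = distr M borel (X 0)" for i
  proof -
    have "distr M borel (X i) = distr M lborel (X i)" for i by (rule distr_cong) auto
    then show ?thesis using distributed_distr_eq_density[OF dist[of i]] distributed_distr_eq_density[OF dist[of 0]] by simp
  qed
  have iid: "iid_square_integrable M Z" unfolding Z_def[abs_def]
  proof (rule iid_square_integrable_image[OF prob_space_axioms indep ident power_vector_measurable])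
    show "integrable M (\<lambda>\<omega>. (norm (power_vector \<alpha> (X 0 \<omega>)))\<^sup>2)"
      unfolding norm_power_vector using \<alpha>
      by (intro Bochner_Integration.integrable_add cauchy_mixture_square_moment[OF dist t' \<sigma>]) auto
  qed
  interpret Z: iid_square_integrable M Z by fact

  have avg: "Xbar = Z.average"
    unfolding assms(15) by (intro ext)
      (simp add: Z.average_def sample_moments_def Z_def power_vector_def prod_eq_iff fst_sum snd_sum
         scaleR_conv_of_real divide_inverse mult.commute)
  have int: "integrable M (\<lambda>\<omega>. cpow (X 0 \<omega>) (real j * \<alpha>))"
    and mom: "(LINT \<omega>|M. cpow (X 0 \<omega>) (real j * \<alpha>)) = (1 - of_real t) * a1 ^ j + of_real t * a2 ^ j"
    if "j \<in> {1..3}" for j :: nat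
  proof -
    have "real j * \<alpha> \<le> 3 * \<alpha>" using that \<alpha> by (intro mult_right_mono) auto
    then have "real j * \<alpha> < 1" using \<alpha> by linarith
    moreover have "0 < real j * \<alpha>" using that \<alpha> by simp
    ultimately have q: "0 < real j * \<alpha>" "real j * \<alpha> < 1" by auto
    show "integrable M (\<lambda>\<omega>. cpow (X 0 \<omega>) (real j * \<alpha>))"
      by (rule cauchy_mixture_power_moment[OF dist t' \<sigma> q])
    have nz: "Complex \<mu>1 \<sigma>1 \<noteq> 0" "Complex \<mu>2 \<sigma>2 \<noteq> 0" using \<sigma> by (auto simp: complex_eq_iff)
    show "(LINT \<omega>|M. cpow (X 0 \<omega>) (real j * \<alpha>)) = (1 - of_real t) * a1 ^ j + of_real t * a2 ^ j"
      unfolding cauchy_mixture_power_moment(2)[OF dist t' \<sigma> q] a1 a2 complex_powr_of_nat_mult[OF nz(1)] complex_powr_of_nat_mult[OF nz(2)] ..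
  qed
  have BB: "B = mixture_moments (of_real t) a1 a2"
    using mom[of 1] mom[of 2] mom[of 3] unfolding assms(13) moments_def mixture_moments_def by simp
  have mean: "Z.mean = B"
  proof -
    have "fst Z.mean = expectation (\<lambda>\<omega>. fst (Z 0 \<omega>))"
      "snd Z.mean = expectation (\<lambda>\<omega>. snd (Z 0 \<omega>))"
      unfolding Z.mean_def
      by (simp_all only: integral_bounded_linear[OF bounded_linear_fst Z.integrable_Z] integral_bounded_linear[OF bounded_linear_snd Z.integrable_Z])
    moreover have "integrable M (\<lambda>\<omega>. snd (Z 0 \<omega>))"
      by (rule integrable_bounded_linear[OF bounded_linear_snd Z.integrable_Z])
    ultimately have "Z.mean = (expectation (\<lambda>\<omega>. fst (Z 0 \<omega>)), expectation (\<lambda>\<omega>. fst (snd (Z 0 \<omega>))), expectation (\<lambda>\<omega>. snd (snd (Z 0 \<omega>))))"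
      by (simp add: prod_eq_iff integral_bounded_linear[OF bounded_linear_fst] integral_bounded_linear[OF bounded_linear_snd])
    then show ?thesis unfolding assms(13) moments_def by (simp add: Z_def power_vector_def)
  qed

  have pw1: "Re a1 > 0" "Im a1 > 0" "a1 powr of_real (1 / \<alpha>) = Complex \<mu>1 \<sigma>1" "norm a1 = norm (Complex \<mu>1 \<sigma>1) powr \<alpha>"
    unfolding a1 using upper_half_plane_powr[of "Complex \<mu>1 \<sigma>1" \<alpha>] \<sigma> \<alpha> \<alpha>' by auto
  have pw2: "Re a2 > 0" "Im a2 > 0" "a2 powr of_real (1 / \<alpha>) = Complex \<mu>2 \<sigma>2" "norm a2 = norm (Complex \<mu>2 \<sigma>2) powr \<alpha>"
    unfolding a2 using upper_half_plane_powr[of "Complex \<mu>2 \<sigma>2" \<alpha>] \<sigma> \<alpha> \<alpha>' by auto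
  have nz: "a1 \<noteq> 0" "a2 \<noteq> 0" "a1 \<notin> \<real>\<^sub>\<le>\<^sub>0" "a2 \<notin> \<real>\<^sub>\<le>\<^sub>0"
    using pw1 pw2 by (auto simp: complex_nonpos_Reals_iff)
  have a12: "a1 \<noteq> a2" using pw1(3) pw2(3) ne by auto
  note inv = tc a12 BB[symmetric, unfolded assms(14)]
  have F1B: "F1 B = (a1 + a2) / 2" and F2B: "F2 B = ((a1 - a2) / 2)\<^sup>2"
    and F5B: "F5 B = a1 / a2 + a2 / a1" and prodB: "(F1 B)\<^sup>2 - F2 B = a1 * a2"
    and F6B: "F6 B = (a1 / a2 - a2 / a1)\<^sup>2"
    unfolding BB using F1_mixture[OF inv] F2_mixture[OF inv] F5_mixture[OF inv nz(1,2)] F6_mixture[OF inv nz(1,2)] by auto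
  have labels: "a1 = F3 B \<and> a2 = F4 B \<or> a2 = F3 B \<and> a1 = F4 B"
    unfolding BB by (rule F3_F4_mixture[OF inv])
  have var: "fst (snd B) - (fst B)\<^sup>2 \<noteq> 0"
    unfolding assms(14) using mixture_variance(2)[OF inv] by simp
  have tB: "complex_of_real t = (a1 - fst B) / (a1 - a2)"
    unfolding BB mixture_moments_def using a12 by (simp add: field_simps)
  have norms: "norm a1 \<noteq> norm a2 \<longleftrightarrow> \<mu>1\<^sup>2 + \<sigma>1\<^sup>2 \<noteq> \<mu>2\<^sup>2 + \<sigma>2\<^sup>2"
  proof -
    have "norm a1 = norm a2 \<longleftrightarrow> norm (Complex \<mu>1 \<sigma>1) = norm (Complex \<mu>2 \<sigma>2)"
      unfolding pw1(4) pw2(4) using \<alpha> powr_inj[of _ _ \<alpha>] 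
      by (metis norm_ge_zero powr_less_mono2 linorder_cases less_irrefl)
    also have "\<dots> \<longleftrightarrow> \<mu>1\<^sup>2 + \<sigma>1\<^sup>2 = \<mu>2\<^sup>2 + \<sigma>2\<^sup>2" by (simp add: cmod_def)
    finally show ?thesis by simp
  qed
  note cons = Z.consistent_differentiable[unfolded mean]
  note plug = consistent_plug_in_differentiable[OF iid mean]

  have labelled: "(AE \<omega> in M. (\<lambda>n. hausdorff_dist {a1hat n \<omega>, a2hat n \<omega>} {a1, a2}) \<longlonglongrightarrow> 0) \<and>
        (Re (a1 - a2) \<noteq> 0 \<longrightarrow>
           (\<exists>\<Sigma>1 :: real ^ 2 ^ 2. \<exists>N. nonneg_definite \<Sigma>1 \<and> normal_distribution 0 \<Sigma>1 N \<and>
              weakly_converges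
                (\<lambda>n. distr M borel (\<lambda>\<omega>. to_R2 (complex_of_real (sqrt (real n)) * (a1hat n \<omega> - a1)))) N) \<and>
           sqrt_n_consistent M a1hat a1 \<and>
           sqrt_n_consistent M a2hat a2) \<and>
        (Re (a1 - a2) = 0 \<longrightarrow>
           norm a1 \<noteq> norm a2 \<and>
           F6 B \<notin> \<real>\<^sub>\<le>\<^sub>0 \<and>
           sqrt_n_consistent M (\<lambda>n \<omega>. ratio_est (Xbar n \<omega>)) (a2 / a1) \<and>
           a1 = (a1 + a2) / (1 + a2 / a1) \<and>
           sqrt_n_consistent M (\<lambda>n \<omega>. a1_est (Xbar n \<omega>)) a1) \<and>
        (Re (a1 - a2) \<noteq> 0 \<longrightarrow>
           consistent_plug_in M \<alpha> (\<lambda>n \<omega>. fst (Xbar n \<omega>)) a1hat a2hat t \<mu>1 \<sigma>1 \<mu>2 \<sigma>2) \<and>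
        (Re (a1 - a2) = 0 \<longrightarrow>
           consistent_plug_in M \<alpha> (\<lambda>n \<omega>. fst (Xbar n \<omega>))
             (\<lambda>n \<omega>. a1_est (Xbar n \<omega>)) (\<lambda>n \<omega>. a2_est (Xbar n \<omega>)) t \<mu>1 \<sigma>1 \<mu>2 \<sigma>2)"
    if lab: "a1 = F3 B" "a2 = F4 B"
  proof (intro conjI impI)
    \<comment> \<open>\<open>F1\<close> and \<open>F2\<close> are continuous at \<open>B\<close> even when the square root in \<open>F3\<close>, \<open>F4\<close> is not.\<close>
    show "AE \<omega> in M. (\<lambda>n. hausdorff_dist {a1hat n \<omega>, a2hat n \<omega>} {a1, a2}) \<longlonglongrightarrow> 0"
      using Z.strong_law unfolding mean
    proof eventually_elim
      case (elim \<omega>)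
      have "(\<lambda>n. F1 (Xbar n \<omega>)) \<longlonglongrightarrow> F1 B" "(\<lambda>n. F2 (Xbar n \<omega>)) \<longlonglongrightarrow> F2 B"
        unfolding avg using F1_F2_differentiable[OF var] 
        by (auto intro!: isCont_tendsto_compose[OF _ elim] differentiable_imp_continuous_within)
      then have "(\<lambda>n. norm (F1 (Xbar n \<omega>) - F1 B) + sqrt (norm (F2 (Xbar n \<omega>) - F2 B))) \<longlonglongrightarrow> norm (F1 B - F1 B) + sqrt (norm (F2 B - F2 B))"
        by (intro tendsto_intros)
      then have lim: "(\<lambda>n. norm (F1 (Xbar n \<omega>) - F1 B) + sqrt (norm (F2 (Xbar n \<omega>) - F2 B))) \<longlonglongrightarrow> 0" by simp
      have b: "0 \<le> hausdorff_dist {a1hat n \<omega>, a2hat n \<omega>} {a1, a2}"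
        "hausdorff_dist {a1hat n \<omega>, a2hat n \<omega>} {a1, a2} \<le> norm (F1 (Xbar n \<omega>) - F1 B) + sqrt (norm (F2 (Xbar n \<omega>) - F2 B))" for n
        using hausdorff_dist_plus_minus[of "F1 (Xbar n \<omega>)" "csqrt (F2 (Xbar n \<omega>))" "F1 B" "csqrt (F2 B)"]
        unfolding a1hat a2hat lab F3_def F4_def by simp_all
      show ?case by (rule tendsto_sandwich[OF _ _ tendsto_const lim]) (use b in auto)
    qed
  next
    assume Re: "Re (a1 - a2) \<noteq> 0"
    then have "F2 B \<notin> \<real>\<^sub>\<le>\<^sub>0" unfolding F2B by (intro power2_notin_nonpos_Reals) simp
    note d = F3_F4_differentiable[OF var this]
    show "sqrt_n_consistent M a1hat a1" "sqrt_n_consistent M a2hat a2"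
      unfolding a1hat a2hat avg using cons[OF _ d(1) lab(1)[symmetric]] cons[OF _ d(2) lab(2)[symmetric]] by simp_all
    show "consistent_plug_in M \<alpha> (\<lambda>n \<omega>. fst (Xbar n \<omega>)) a1hat a2hat t \<mu>1 \<sigma>1 \<mu>2 \<sigma>2"
      unfolding a1hat a2hat avg
      by (rule plug[OF _ _ d]) (use a12 nz tB pw1 pw2 in \<open>simp_all add: lab[symmetric]\<close>)
    obtain D where D: "(F3 has_derivative D) (at B)" using d(1) by (auto simp: differentiable_def)
    have D': "((\<lambda>x. to_R2 (F3 x)) has_derivative (\<lambda>x. to_R2 (D x))) (at Z.mean)"
      unfolding mean by (rule bounded_linear.has_derivative[OF bounded_linear_to_R2 D])
    have [measurable]: "to_R2 \<in> borel_measurable borel"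
      by (intro borel_measurable_continuous_onI linear_continuous_on bounded_linear_to_R2)
    interpret R2: bounded_linear to_R2 by (rule bounded_linear_to_R2)
    have "to_R2 (complex_of_real (sqrt (real n)) * (a1hat n \<omega> - a1)) = sqrt (real n) *\<^sub>R (to_R2 (F3 (Z.average n \<omega>)) - to_R2 (F3 Z.mean))" for n \<omega>
      unfolding a1hat avg mean lab(1)[symmetric] R2.diff[symmetric] R2.scaleR[symmetric]
      by (simp only: scaleR_conv_of_real)
    then show "\<exists>\<Sigma>1 :: real ^ 2 ^ 2. \<exists>N. nonneg_definite \<Sigma>1 \<and> normal_distribution 0 \<Sigma>1 N \<and>
              weakly_converges
                (\<lambda>n. distr M borel (\<lambda>\<omega>. to_R2 (complex_of_real (sqrt (real n)) * (a1hat n \<omega> - a1)))) N"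
      using Z.delta_method[OF _ D'] by simp
  next
    assume Re: "Re (a1 - a2) = 0"
    have Im: "Im (a1 - a2) > 0"
      using F3_eq_imp(2)[OF inv _ Re] lab(1) unfolding BB by simp
    have less: "norm a2 < norm a1"
    proof -
      have "(Im a2)\<^sup>2 < (Im a1)\<^sup>2" using Im pw2 by (intro power_strict_mono) auto
      then show ?thesis using Re by (simp add: cmod_def)
    qed
    then show "norm a1 \<noteq> norm a2" by simp
    have pos: "Re (a1 / a2 - a2 / a1) > 0" by (rule Re_ratio_difference_pos[OF pw1(1) pw2(1) pw1(2) pw2(2) less])
    then show F6n: "F6 B \<notin> \<real>\<^sub>\<le>\<^sub>0" unfolding F6B by (intro power2_notin_nonpos_Reals) simp
    have ratioB: "ratio_est B = a2 / a1"
      unfolding ratio_est_def F5B F6B using pos by (subst csqrt_square) auto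
    have "Re (a1 + a2) > 0" using pw1 pw2 by simp
    then have "a1 + a2 \<noteq> 0" by (metis less_irrefl zero_complex.sel(1))
    then have r1: "1 + a2 / a1 \<noteq> 0" using nz by (simp add: field_simps add_eq_0_iff)
    show a1eq: "a1 = (a1 + a2) / (1 + a2 / a1)" using r1 nz by (simp add: divide_simps)
    have a1B: "a1_est B = a1" proof -
      have "a1_est B = (a1 + a2) / (1 + a2 / a1)" unfolding a1_est_def F1B ratioB by (rule arg_cong2[of _ _ _ _ "(/)"]) simp_all
      then show ?thesis using a1eq by simp
    qed
    have a2B: "a2_est B = a2" unfolding a2_est_def a1B ratioB using nz by simp
    have prod: "(F1 B)\<^sup>2 - F2 B \<noteq> 0" unfolding prodB using nz by simp
    note dr = ratio_est_differentiable[OF var prod F6n]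
    note d = a1_est_differentiable[OF var prod F6n r1[folded ratioB]]
    show "sqrt_n_consistent M (\<lambda>n \<omega>. ratio_est (Xbar n \<omega>)) (a2 / a1)"
      "sqrt_n_consistent M (\<lambda>n \<omega>. a1_est (Xbar n \<omega>)) a1"
      unfolding avg using cons[OF _ dr ratioB] cons[OF _ d(1) a1B] by simp_all
    show "consistent_plug_in M \<alpha> (\<lambda>n \<omega>. fst (Xbar n \<omega>))
             (\<lambda>n \<omega>. a1_est (Xbar n \<omega>)) (\<lambda>n \<omega>. a2_est (Xbar n \<omega>)) t \<mu>1 \<sigma>1 \<mu>2 \<sigma>2"
      unfolding avg
      by (rule plug[OF _ _ d]) (use a12 nz tB pw1 pw2 in \<open>simp_all add: a1B a2B\<close>)
  qed
  have tB1: "complex_of_real t = (a1 - B1) / (a1 - a2)" using tB unfolding assms(14) by simp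
  show ?thesis
    by (intro conjI ballI int a12 tB1 pw1(3)[symmetric] pw2(3)[symmetric] labels)
      (use labelled F5B F6B norms in blast)+
qed

end
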